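(* Let $(G,H,\mathcal L)$ be a cut-and-project scheme with $G$ amenable, and let $W\subseteq H$ be relatively compact. Then \[ \frac{m_H(\mathring{W})}{\mathrm{covol}(\mathcal{L})} \le \mathrm{L}^-_{\Lambda_{\mathring{W}}} \le \mathrm{L}^-_{\Lambda_{W}} \le \mathrm{L}^+_{\Lambda_{W}}\le \mathrm{L}^+_{\Lambda_{\overline{W}}} \le \frac{m_H(\overline{W})}{\mathrm{covol}(\mathcal{L})} . \] In particular, if $W$ is Riemann measurable, then $\Lambda_W$ has Leptin density $\mathrm{L}_{\Lambda_{W}}= m_H(W)/\mathrm{covol}(\mathcal{L})$.
   Context: A cut-and-project scheme $(G,H,\mathcal L)$ consists of unimodular locally compact (Hausdorff) groups $G,H$ and a uniform lattice $\mathcal L$ (countable discrete cocompact subgroup) in $G\times H$ such that the canonical projection $\pi^G$ restricted to $\mathcal L$ is injective and $\pi^H(\mathcal L)$ is dense in $H$. Fix Haar measures $m_G,m_H$ and the product Haar measure on $G\times H$. $\mathrm{covol}(\mathcal L)$ is the Haar measure of any measurable relatively compact fundamental domain of $\mathcal L$ in $G\times H$. For $S\subseteq H$, $\Lambda_S=\pi^G(\mathcal L\cap(G\times S))$, identified with the counting measure $\delta_{\Lambda_S}(A)=\mathrm{card}(\Lambda_S\cap A)$ on $G$. $\mathring W$, $\overline W$ denote interior and closure; $W$ is Riemann measurable if $m_H(\overline W\setminus\mathring W)=0$. $G$ is amenable if it admits a left-invariant mean on $L^\infty(G)$. With $\mathcal K$ the nonempty compact subsets of $G$ and $\mathcal K_p$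 those of positive $m_G$-measure, the Leptin densities of a measure $\nu$ on $G$ are $\mathrm{L}_\nu^-=\sup_{K\in \mathcal K}\inf_{A\in \mathcal K_p} \nu(KA)/m_G(A)$ and $\mathrm{L}_\nu^+=\inf_{K\in \mathcal K}\sup_{A\in \mathcal K_p} \nu(A)/m_G(KA)$; if they coincide, the common value is the Leptin density $\mathrm{L}_\nu$. We write $\mathrm{L}^\pm_{\Lambda_S}$ for $\mathrm{L}^\pm_{\delta_{\Lambda_S}}$. *)

theory Defs
  imports "HOL-Analysis.Analysis"
begin

text \<open>Groups are written additively (class group_add, not necessarily commutative).
  A Haar measure is a left-invariant Radon measure on the Borel sets
  (finite on compacts, positive on nonempty open sets, outer regular on Borel
  sets, inner regular on open sets).\<close>

definition haar_measure :: "('a::{topological_space,group_add}) measure \<Rightarrow> bool" where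
  "haar_measure m \<longleftrightarrow>
     sets m = sets borel \<and>
     (\<forall>K. compact K \<longrightarrow> emeasure m K < \<infinity>) \<and>
     (\<forall>U. open U \<and> U \<noteq> {} \<longrightarrow> emeasure m U > 0) \<and>
     (\<forall>g A. A \<in> sets borel \<longrightarrow> emeasure m ((\<lambda>x. g + x) ` A) = emeasure m A) \<and>
     (\<forall>A \<in> sets borel. emeasure m A = (INF U \<in> {U. open U \<and> A \<subseteq> U}. emeasure m U)) \<and>
     (\<forall>U. open U \<longrightarrow> emeasure m U = (SUP K \<in> {K. compact K \<and> K \<subseteq> U}. emeasure m K))"

definition unimodular :: "('a::{topological_space,group_add}) measure \<Rightarrow> bool" where
  "unimodular m \<longleftrightarrow>
     (\<forall>g A. A \<in> sets borel \<longrightarrow> emeasure m ((\<lambda>x. x + g) ` A) = emeasure m A)"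

text \<open>Amenable: existence of a left-invariant mean on L-infinity(G).  Elements of
  L-infinity are represented by essentially bounded Borel functions; the mean
  must respect almost-everywhere equality.\<close>
definition Linfty :: "'a measure \<Rightarrow> ('a \<Rightarrow> real) set" where
  "Linfty m = {f. f \<in> borel_measurable m \<and> (\<exists>C. AE x in m. \<bar>f x\<bar> \<le> C)}"

definition amenable :: "('a::group_add) measure \<Rightarrow> bool" where
  "amenable m \<longleftrightarrow> (\<exists>M :: ('a \<Rightarrow> real) \<Rightarrow> real.
     (\<forall>f\<in>Linfty m. \<forall>g\<in>Linfty m. \<forall>a b. M (\<lambda>x. a * f x + b * g x) = a * M f + b * M g) \<and>
     (\<forall>f\<in>Linfty m. (AE x in m. 0 \<le> f x) \<longrightarrow> 0 \<le> M f) \<and>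
     M (\<lambda>_. 1) = 1 \<and>
     (\<forall>f\<in>Linfty m. \<forall>g\<in>Linfty m. (AE x in m. f x = g x) \<longrightarrow> M f = M g) \<and>
     (\<forall>f\<in>Linfty m. \<forall>y. M (\<lambda>x. f (y + x)) = M f))"

definition uniform_lattice :: "('a::{topological_space,group_add}) set \<Rightarrow> bool" where
  "uniform_lattice L \<longleftrightarrow>
     countable L \<and> 0 \<in> L \<and> (\<forall>x\<in>L. \<forall>y\<in>L. x + y \<in> L) \<and> (\<forall>x\<in>L. - x \<in> L) \<and>
     (\<forall>x\<in>L. \<exists>U. open U \<and> U \<inter> L = {x}) \<and>
     (\<exists>K. compact K \<and> (\<forall>z. \<exists>k\<in>K. \<exists>l\<in>L. z = l + k))"

definition cut_and_project_scheme ::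
  "('g::{topological_group_add,t2_space}) measure \<Rightarrow> ('h::{topological_group_add,t2_space}) measure
    \<Rightarrow> ('g \<times> 'h) set \<Rightarrow> bool" where
  "cut_and_project_scheme mG mH L \<longleftrightarrow>
     locally_compact_space (euclidean :: 'g topology) \<and>
     locally_compact_space (euclidean :: 'h topology) \<and>
     haar_measure mG \<and> unimodular mG \<and> haar_measure mH \<and> unimodular mH \<and>
     uniform_lattice L \<and> inj_on fst L \<and> closure (snd ` L) = UNIV"

definition product_haar ::
  "('g::{topological_space,group_add}) measure \<Rightarrow> ('h::{topological_space,group_add}) measure
    \<Rightarrow> ('g \<times> 'h) measure \<Rightarrow> bool" where
  "product_haar mG mH m \<longleftrightarrow> haar_measure m \<and>
     (\<forall>A B. compact A \<longrightarrow> compact B \<longrightarrow> emeasure m (A \<times> B) = emeasure mG A * emeasure mH B)"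

definition fundamental_domain :: "('a::{topological_space,group_add}) measure \<Rightarrow> 'a set \<Rightarrow> 'a set \<Rightarrow> bool" where
  "fundamental_domain m L F \<longleftrightarrow> F \<in> sets m \<and> compact (closure F) \<and>
     (\<forall>z. \<exists>!l. l \<in> L \<and> z \<in> (\<lambda>x. l + x) ` F)"

text \<open>Covolume: measure of a measurable relatively compact fundamental domain
  (independent of the choice).\<close>
definition covol :: "('a::{topological_space,group_add}) measure \<Rightarrow> 'a set \<Rightarrow> real" where
  "covol m L = measure m (SOME F. fundamental_domain m L F)"

definition model_set :: "('g \<times> 'h) set \<Rightarrow> 'h set \<Rightarrow> 'g set" where
  "model_set L S = fst ` (L \<inter> (UNIV \<times> S))"

definition delta :: "'a set \<Rightarrow> 'a set \<Rightarrow> ereal" where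
  "delta X A = (if finite (X \<inter> A) then ereal (real (card (X \<inter> A))) else \<infinity>)"

definition set_mult :: "('a::plus) set \<Rightarrow> 'a set \<Rightarrow> 'a set" where
  "set_mult K A = {k + a | k a. k \<in> K \<and> a \<in> A}"

definition leptin_lower :: "('a::{plus,topological_space}) measure \<Rightarrow> ('a set \<Rightarrow> ereal) \<Rightarrow> ereal" where
  "leptin_lower m \<nu> = (SUP K \<in> {K. compact K \<and> K \<noteq> {}}.
      INF A \<in> {A. compact A \<and> A \<noteq> {} \<and> 0 < measure m A}. \<nu> (set_mult K A) / ereal (measure m A))"

definition leptin_upper :: "('a::{plus,topological_space}) measure \<Rightarrow> ('a set \<Rightarrow> ereal) \<Rightarrow> ereal" where
  "leptin_upper m \<nu> = (INF K \<in> {K. compact K \<and> K \<noteq> {}}.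
      SUP A \<in> {A. compact A \<and> A \<noteq> {} \<and> 0 < measure m A}. \<nu> A / ereal (measure m (set_mult K A)))"

definition riemann_measurable :: "('a::topological_space) measure \<Rightarrow> 'a set \<Rightarrow> bool" where
  "riemann_measurable m W \<longleftrightarrow> measure m (closure W - interior W) = 0"

end

theory Submission
  imports Defs
begin


text \<open>
  Since \<open>snd ` L\<close> is dense, \<open>L\<close> has a fundamental domain \<open>F\<close> inside \<open>K \<times> V\<close> with \<open>K\<close> compact and
  \<open>V\<close> an arbitrarily small neighbourhood of \<open>0\<close>.  The translates \<open>l + F\<close> are disjoint and cover the
  product, so counting the points of \<open>L\<close> in \<open>A \<times> S\<close> amounts to comparing Haar measures, with an error
  absorbed by \<open>K\<close> and \<open>V\<close>.  As \<open>L\<close> acts on the left while Leptin densities thicken \<open>A\<close> on the left,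
  the comparison is made for \<open>-A \<times> -S\<close>; unimodularity makes the Haar measures invariant under inversion.
  This gives the outermost bounds without amenability.

  For the middle inequality, which holds for every countable \<open>X \<subseteq> G\<close>, suppose
  \<open>L\<^sup>+ < c' < c < L\<^sup>-\<close>.  Then some compact \<open>R\<close> satisfies \<open>|X \<inter> (R + A)| \<ge> (c / c') |X \<inter> A|\<close> for all
  compact \<open>A\<close>, and iterating gives a compact \<open>P\<close> with \<open>|X \<inter> (P + F)| \<ge> 2 |F|\<close> for finite \<open>F \<subseteq> X\<close>.  By
  Hall's theorem there are two injections of \<open>X\<close> into itself with disjoint images that move each
  point by an element of \<open>P\<close>.  The mean of \<open>g \<mapsto> \<Sum>x\<in>X. \<psi> (g - \<phi> x)\<close>, for a bump function \<open>\<psi>\<close>, does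
  not depend on a displacement \<open>\<phi>\<close> bounded in this sense, by the double integral that proves
  uniqueness of Haar measure; so \<open>X\<close> would have at least twice its own positive mean density.
\<close>

section \<open>Hall's marriage theorem for infinite families of finite sets\<close>

definition hall_condition :: "'i set \<Rightarrow> ('i \<Rightarrow> 'b set) \<Rightarrow> bool" where
  "hall_condition I N \<longleftrightarrow> (\<forall>J. finite J \<longrightarrow> J \<subseteq> I \<longrightarrow> card J \<le> card (\<Union>j\<in>J. N j))"

text \<open>Rado's argument: if both removals violate the condition, submodularity of
  \<open>J \<mapsto> card (\<Union>j\<in>J. N j)\<close> contradicts it for the union of the two violating index sets and \<open>i\<close>.\<close>

lemma hall_condition_fun_upd_remove:
  fixes N :: "'i \<Rightarrow> 'b set"
  assumes fin: "\<And>i. i \<in> I \<Longrightarrow> finite (N i)" and hall: "hall_condition I N"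
    and i: "i \<in> I" and ab: "a \<noteq> b"
  shows "hall_condition I (N(i := N i - {a})) \<or> hall_condition I (N(i := N i - {b}))"
proof (rule ccontr)
  assume neg: "\<not> ?thesis"
  \<comment> \<open>A violating set must contain \<open>i\<close>, because away from
    \<open>i\<close> the family is unchanged. Taking \<open>i\<close> out of it uses up the
    strictness of the inequality.\<close>
  have violator: "\<exists>J. finite J \<and> J \<subseteq> I \<and> i \<notin> J \<and> card ((\<Union>j\<in>J. N j) \<union> (N i - {c})) \<le> card J"
    if "\<not> hall_condition I (N(i := N i - {c}))" for c
  proof -
    obtain J where J: "finite J" "J \<subseteq> I" "card (\<Union>j\<in>J. (N(i := N i - {c})) j) < card J"
      using \<open>\<not> hall_condition I (N(i := N i - {c}))\<close> unfolding hall_condition_def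
      by (meson not_le)
    have "i \<in> J"
    proof (rule ccontr)
      assume "i \<notin> J"
      then have "(\<Union>j\<in>J. (N(i := N i - {c})) j) = (\<Union>j\<in>J. N j)" by auto
      then show False using J hall unfolding hall_condition_def by (metis not_le)
    qed
    have "(\<Union>j\<in>J. (N(i := N i - {c})) j) = (\<Union>j\<in>J - {i}. N j) \<union> (N i - {c})"
      using \<open>i \<in> J\<close> by (auto split: if_splits)
    moreover have "card J = Suc (card (J - {i}))"
      using \<open>i \<in> J\<close> J(1) by (simp only: card_Suc_Diff1)
    ultimately show ?thesis using J by (intro exI[of _ "J - {i}"]) (simp add: subset_iff)
  qed
  obtain J where J: "finite J" "J \<subseteq> I" "i \<notin> J" "card ((\<Union>j\<in>J. N j) \<union> (N i - {a})) \<le> card J"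
    using violator[of a] neg by blast
  obtain J' where J': "finite J'" "J' \<subseteq> I" "i \<notin> J'" "card ((\<Union>j\<in>J'. N j) \<union> (N i - {b})) \<le> card J'"
    using violator[of b] neg by blast
  define A where "A = (\<Union>j\<in>J. N j) \<union> (N i - {a})"
  define B where "B = (\<Union>j\<in>J'. N j) \<union> (N i - {b})"
  have fAB: "finite A" "finite B" using J J' fin i by (auto simp: A_def B_def)
  \<comment> \<open>Because \<open>a \<noteq> b\<close>, the two truncated copies of
    \<open>N i\<close> together give back all of \<open>N i\<close>. Hall's condition then gains one
    unit at \<open>insert i (J \<union> J')\<close>, and this unit is the contradiction.\<close>
  have "A \<union> B = (\<Union>j\<in>insert i (J \<union> J'). N j)" using ab by (auto simp: A_def B_def)
  moreover have "card (insert i (J \<union> J')) \<le> card (\<Union>j\<in>insert i (J \<union> J'). N j)"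
    using J J' i by (intro hall[unfolded hall_condition_def, rule_format]) auto
  moreover have "card (insert i (J \<union> J')) = Suc (card (J \<union> J'))" using J J' by simp
  ultimately have 1: "Suc (card (J \<union> J')) \<le> card (A \<union> B)" by simp
  have "card (J \<inter> J') \<le> card (\<Union>j\<in>J \<inter> J'. N j)"
    using J J' by (intro hall[unfolded hall_condition_def, rule_format]) auto
  also have "\<dots> \<le> card (A \<inter> B)" by (rule card_mono) (use fAB in \<open>auto simp: A_def B_def\<close>)
  finally have 2: "card (J \<inter> J') \<le> card (A \<inter> B)" .
  have "card J + card J' = card (J \<union> J') + card (J \<inter> J')" using J J' by (intro card_Un_Int)
  moreover have "card A + card B = card (A \<union> B) + card (A \<inter> B)" using fAB by (intro card_Un_Int)
  ultimately show False using 1 2 J(4) J'(4) unfolding A_def B_def by linarith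
qed

text \<open>Zorn's lemma picks a maximal set \<open>R\<close> of pairs that can be deleted without
  destroying Hall's condition. By the previous lemma maximality leaves exactly one candidate for
  each index, and Hall's condition on two-element index sets makes this choice injective.\<close>

theorem hall_marriage:
  fixes N :: "'i \<Rightarrow> 'b set"
  assumes fin: "\<And>i. i \<in> I \<Longrightarrow> finite (N i)" and hall: "hall_condition I N"
  obtains f where "inj_on f I" "\<And>i. i \<in> I \<Longrightarrow> f i \<in> N i"
proof -
  define T where "T R i = {y \<in> N i. (i, y) \<notin> R}" for R i
  define \<A> where "\<A> = {R. R \<subseteq> Sigma I N \<and> hall_condition I (T R)}"
  have "T {} = N" by (auto simp: T_def)
  then have ne: "\<A> \<noteq> {}" using hall by (auto simp: \<A>_def intro!: exI[of _ "{}"])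
  have ch: "\<Union>\<C> \<in> \<A>" if C: "\<C> \<noteq> {}" "subset.chain \<A> \<C>" for \<C>
  proof -
    have CA: "\<C> \<subseteq> \<A>" using C(2) by (simp add: subset.chain_def)
    have "card J \<le> card (\<Union>j\<in>J. T (\<Union>\<C>) j)" if J: "finite J" "J \<subseteq> I" for J
    proof -
      \<comment> \<open>Only finitely many pairs start in \<open>J\<close>, so one member of the
        chain already contains all of them that the union deletes.\<close>
      have "finite (Sigma J N \<inter> \<Union>\<C>)" using J fin by (intro finite_Int disjI1 finite_SigmaI) auto
      then obtain R where R: "R \<in> \<C>" "Sigma J N \<inter> \<Union>\<C> \<subseteq> R"
        using finite_subset_Union_chain[OF _ _ C] by (metis inf_le2)
      have "T (\<Union>\<C>) j = T R j" if "j \<in> J" for j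
        using R that by (auto simp: T_def)
      then have "(\<Union>j\<in>J. T (\<Union>\<C>) j) = (\<Union>j\<in>J. T R j)" by simp
      moreover have "hall_condition I (T R)" using R CA by (auto simp: \<A>_def)
      ultimately show ?thesis using J unfolding hall_condition_def by metis
    qed
    then show ?thesis using CA by (auto simp: \<A>_def hall_condition_def)
  qed
  obtain R where R: "R \<in> \<A>" and max: "\<And>X. X \<in> \<A> \<Longrightarrow> R \<subseteq> X \<Longrightarrow> X = R"
    using subset_Zorn_nonempty[OF ne ch] by blast
  have hR: "hall_condition I (T R)" and RS: "R \<subseteq> Sigma I N" using R by (auto simp: \<A>_def)
  have finT: "finite (T R i)" if "i \<in> I" for i using fin[OF that] by (simp add: T_def)
  have uniq: "a = b" if "i \<in> I" "a \<in> T R i" "b \<in> T R i" for i a b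
  proof (rule ccontr)
    have no: "\<not> hall_condition I ((T R)(i := T R i - {c}))" if c: "c \<in> T R i" for c
    proof
      assume "hall_condition I ((T R)(i := T R i - {c}))"
      moreover have "(T R)(i := T R i - {c}) = T (insert (i, c) R)"
        by (rule ext) (auto simp: T_def fun_upd_def)
      ultimately have "insert (i, c) R \<in> \<A>"
        using RS c \<open>i \<in> I\<close> by (auto simp: \<A>_def T_def)
      then have "insert (i, c) R = R" by (rule max) auto
      then show False using c by (auto simp: T_def)
    qed
    assume "a \<noteq> b"
    from hall_condition_fun_upd_remove[where N = "T R", OF finT hR \<open>i \<in> I\<close> this] no that show False by blast
  qed
  have nonempty: "T R i \<noteq> {}" if "i \<in> I" for i
    using hR that unfolding hall_condition_def by (auto dest: spec[of _ "{i}"])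
  define f where "f i = (SOME y. y \<in> T R i)" for i
  have fT: "f i \<in> T R i" if "i \<in> I" for i
    unfolding f_def using nonempty[OF that] by (simp add: some_in_eq)
  have Teq: "T R i = {f i}" if "i \<in> I" for i using fT[OF that] uniq[OF that] by blast
  show ?thesis
  proof
    show "inj_on f I"
    proof (rule inj_onI, rule ccontr)
      fix i j assume ij: "i \<in> I" "j \<in> I" "f i = f j" "i \<noteq> j"
      then have "(\<Union>k\<in>{i, j}. T R k) = {f i}" using Teq by auto
      moreover have "card {i, j} \<le> card (\<Union>k\<in>{i, j}. T R k)"
        using hR[unfolded hall_condition_def, rule_format, of "{i, j}"] ij by simp
      ultimately show False using ij by simp
    qed
    show "f i \<in> N i" if "i \<in> I" for i using fT[OF that] by (simp add: T_def)
  qed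
qed

text \<open>Each index is doubled by a boolean tag: expansion by the factor two is Hall's condition
  on \<open>I \<times> UNIV\<close>, and the two tags yield the two injections.\<close>

corollary hall_marriage_two:
  fixes N :: "'i \<Rightarrow> 'b set"
  assumes fin: "\<And>i. i \<in> I \<Longrightarrow> finite (N i)"
    and dbl: "\<And>J. finite J \<Longrightarrow> J \<subseteq> I \<Longrightarrow> 2 * card J \<le> card (\<Union>j\<in>J. N j)"
  obtains f g where "inj_on f I" "inj_on g I" "f ` I \<inter> g ` I = {}"
    "\<And>i. i \<in> I \<Longrightarrow> f i \<in> N i" "\<And>i. i \<in> I \<Longrightarrow> g i \<in> N i"
proof -
  have "hall_condition (I \<times> (UNIV::bool set)) (\<lambda>p. N (fst p))"
    unfolding hall_condition_def
  proof (intro allI impI)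
    fix J :: "('i \<times> bool) set" assume J: "finite J" "J \<subseteq> I \<times> UNIV"
    have "card J \<le> card (fst ` J \<times> (UNIV::bool set))"
      using J by (intro card_mono) (auto simp: image_iff, force)
    also have "\<dots> = 2 * card (fst ` J)" by (simp add: card_cartesian_product card_UNIV_bool)
    also have "\<dots> \<le> card (\<Union>j\<in>fst ` J. N j)" using J by (intro dbl) auto
    finally show "card J \<le> card (\<Union>j\<in>J. N (fst j))" by simp
  qed
  then obtain h where h: "inj_on h (I \<times> UNIV)" "\<And>p. p \<in> I \<times> (UNIV::bool set) \<Longrightarrow> h p \<in> N (fst p)"
    by (rule hall_marriage[rotated]) (use fin in auto)
  show ?thesis
  proof
    show "inj_on (\<lambda>i. h (i, True)) I" "inj_on (\<lambda>i. h (i, False)) I"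
      using h(1) by (auto simp: inj_on_def)
    show "(\<lambda>i. h (i, True)) ` I \<inter> (\<lambda>i. h (i, False)) ` I = {}"
      using h(1) by (auto simp: inj_on_def)
  qed (use h(2) in force)+
qed


section \<open>Locally compact groups\<close>

lemma set_mult_I: "k \<in> K \<Longrightarrow> a \<in> A \<Longrightarrow> k + a \<in> set_mult K A"
  by (auto simp: set_mult_def)

lemma set_mult_image: "set_mult K A = (\<lambda>(k, a). k + a) ` (K \<times> A)"
  by (auto simp: set_mult_def)

lemma set_mult_mono: "K \<subseteq> K' \<Longrightarrow> A \<subseteq> A' \<Longrightarrow> set_mult K A \<subseteq> set_mult K' A'"
  by (auto simp: set_mult_def)

lemma set_mult_assoc:
  "set_mult (set_mult K K') A = set_mult K (set_mult K' (A::'a::semigroup_add set))"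
proof (intro equalityI subsetI)
  fix x assume "x \<in> set_mult (set_mult K K') A"
  then obtain k k' a where "x = k + (k' + a)" "k \<in> K" "k' \<in> K'" "a \<in> A"
    by (auto simp: set_mult_def add.assoc)
  then show "x \<in> set_mult K (set_mult K' A)" by (simp add: set_mult_I)
next
  fix x assume "x \<in> set_mult K (set_mult K' A)"
  then obtain k k' a where "x = (k + k') + a" "k \<in> K" "k' \<in> K'" "a \<in> A"
    by (auto simp: set_mult_def add.assoc[symmetric])
  then show "x \<in> set_mult (set_mult K K') A" by (simp only: set_mult_I)
qed

lemma set_mult_eq_empty: "set_mult K A = {} \<longleftrightarrow> K = {} \<or> A = {}"
  by (auto simp: set_mult_def)

lemma compact_set_mult:
  fixes A B :: "'a::topological_group_add set"
  assumes "compact A" "compact B"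
  shows "compact (set_mult A B)"
  unfolding set_mult_image
  by (rule compact_continuous_image)
    (auto intro!: continuous_intros compact_Times assms simp: case_prod_beta)

lemma compact_uminus:
  fixes A :: "'a::topological_group_add set"
  shows "compact A \<Longrightarrow> compact (uminus ` A)"
  by (rule compact_continuous_image) (auto intro!: continuous_intros)

text \<open>Rewrites the points seen from \<open>g\<close> through \<open>D\<close> as the points of
  \<open>X\<close> in a right translate of \<open>-D\<close>. Local finiteness and right invariance
  of the measure then apply to them.\<close>

lemma diff_mem_eq_Int_set_mult:
  fixes X D :: "'a::group_add set"
  shows "{x \<in> X. g - x \<in> D} = X \<inter> set_mult (uminus ` D) {g}"
proof (intro equalityI subsetI)
  fix x assume "x \<in> {x \<in> X. g - x \<in> D}"
  then have x: "x \<in> X" "g - x \<in> D" by auto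
  have "- (g - x) + g \<in> set_mult (uminus ` D) {g}" using x by (intro set_mult_I imageI) auto
  then show "x \<in> X \<inter> set_mult (uminus ` D) {g}" using x by simp
next
  fix x assume "x \<in> X \<inter> set_mult (uminus ` D) {g}"
  then obtain d where d: "x \<in> X" "d \<in> D" "x = - d + g" by (auto simp: set_mult_def)
  have "g - (- d + g) = d" by (simp only: diff_conv_add_uminus minus_add minus_minus add_minus_cancel)
  then show "x \<in> {x \<in> X. g - x \<in> D}" using d by simp
qed

lemma open_set_mult_right:
  fixes A B :: "'a::topological_group_add set"
  assumes "open A"
  shows "open (set_mult A B)"
proof -
  have "set_mult A B = (\<Union>b\<in>B. (\<lambda>x. x - b) -` A)"
    unfolding set_mult_def by (force simp: vimage_def)
  then show ?thesis
    by (auto intro!: open_vimage assms continuous_intros)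
qed

lemma compact_translate:
  fixes A :: "'a::topological_group_add set"
  shows "compact A \<Longrightarrow> compact ((\<lambda>x. g + x) ` A)" "compact A \<Longrightarrow> compact ((\<lambda>x. x + g) ` A)"
  by (rule compact_continuous_image; auto intro!: continuous_intros)+

lemma Hausdorff_space_euclidean_t2: "Hausdorff_space (euclidean :: 'a::t2_space topology)"
  unfolding Hausdorff_space_def by (simp add: disjnt_def) (metis hausdorff)

lemma compact_nhds_zero:
  assumes "locally_compact_space (euclidean :: 'a::{topological_group_add,t2_space} topology)"
    and "open W" "(0::'a) \<in> W"
  obtains U V where "open U" "compact V" "0 \<in> U" "U \<subseteq> V" "V \<subseteq> W"
proof -
  have "neighbourhood_base_of (compactin euclidean) (euclidean :: 'a topology)"
    using assms(1) locally_compact_space_neighbourhood_base[of "euclidean :: 'a topology"]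
    by (simp add: Hausdorff_space_euclidean_t2)
  then show ?thesis
    using that assms(2,3) unfolding neighbourhood_base_of_def neighbourhood_base_at_def by force
qed

lemma open_nhds_zero_set_mult_subset:
  fixes K :: "'a::topological_group_add set"
  assumes "compact K" "open W" "K \<subseteq> W"
  obtains U where "open U" "0 \<in> U" "set_mult U K \<subseteq> W"
proof -
  have "open ((\<lambda>(v, k). v + k) -` W)"
    by (rule open_vimage) (auto intro!: continuous_intros assms simp: case_prod_beta)
  moreover have "{0} \<times> K \<subseteq> (\<lambda>(v, k). v + k) -` W" using assms(3) by auto
  ultimately obtain U where "0 \<in> U" "open U" "U \<times> K \<subseteq> (\<lambda>(v, k). v + k) -` W"
    using Elementary_Topology.tube_lemma[OF assms(1)] by metis
  then show ?thesis by (intro that[of U]) (auto simp: set_mult_def)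
qed

lemma compact_nhds_zero_set_mult_subset:
  fixes K :: "'a::{topological_group_add,t2_space} set"
  assumes "locally_compact_space (euclidean :: 'a topology)" "compact K" "open W" "K \<subseteq> W"
  obtains U V where "open U" "0 \<in> U" "U \<subseteq> V" "compact V" "set_mult V K \<subseteq> W"
proof -
  obtain U' where U': "open U'" "0 \<in> U'" "set_mult U' K \<subseteq> W"
    using open_nhds_zero_set_mult_subset[OF assms(2-4)] by blast
  obtain U V where "open U" "compact V" "0 \<in> U" "U \<subseteq> V" "V \<subseteq> U'"
    using compact_nhds_zero[OF assms(1) U'(1,2)] by blast
  then show ?thesis using that set_mult_mono[of V U' K K] U' by blast
qed

text \<open>A locally compact Hausdorff space is completely regular, so \<open>K\<close> can be
  separated from the complement of the open set \<open>U + K\<close>. The support then lies in the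
  compact set \<open>V + K\<close>, which is still inside \<open>W\<close>.\<close>

lemma Urysohn_compact_support:
  fixes K :: "'a::{topological_group_add,t2_space} set"
  assumes lc: "locally_compact_space (euclidean :: 'a topology)" and "compact K" "open W" "K \<subseteq> W"
  obtains f :: "'a \<Rightarrow> real" and D where "continuous_on UNIV f" "compact D" "D \<subseteq> W"
    "\<And>x. x \<notin> D \<Longrightarrow> f x = 0" "\<And>x. x \<in> K \<Longrightarrow> f x = 1" "\<And>x. 0 \<le> f x" "\<And>x. f x \<le> 1"
proof -
  obtain U V where UV: "open U" "0 \<in> U" "U \<subseteq> V" "compact V" "set_mult V K \<subseteq> W"
    using compact_nhds_zero_set_mult_subset[OF assms] by blast
  have "completely_regular_space (euclidean :: 'a topology)"
    using lc by (simp add: Hausdorff_space_euclidean_t2 locally_compact_Hausdorff_imp_regular_space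
        locally_compact_regular_imp_completely_regular_space)
  moreover have "closedin euclidean (- set_mult U K)"
    using open_set_mult_right[OF UV(1)] by (simp add: closed_def)
  moreover have "K \<subseteq> set_mult U K"
    using UV(2) set_mult_I[of 0 U _ K] by fastforce
  ultimately obtain f where f: "continuous_map euclidean (subtopology euclidean {0..1::real}) f"
    "f ` (- set_mult U K) \<subseteq> {0}" "f ` K \<subseteq> {1}"
    using Urysohn_completely_regular_compact_closed[of 0 1 "euclidean :: 'a topology" K "- set_mult U K"]
      \<open>compact K\<close> by (simp add: disjnt_iff subset_iff) blast
  have "set_mult U K \<subseteq> set_mult V K" using UV(3) by (intro set_mult_mono) auto
  moreover have "f x \<in> {0..1}" for x
    using continuous_map_image_subset_topspace[OF f(1)] by (simp add: image_subset_iff)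
  moreover have "continuous_on UNIV f"
    using f(1) by (simp add: continuous_map_in_subtopology)
  ultimately show ?thesis
    using that[of f "set_mult V K"] f UV compact_set_mult[OF UV(4) \<open>compact K\<close>]
    by (fastforce simp: image_subset_iff)
qed

lemma compact_support_uniformly_continuous:
  fixes f :: "'a::{topological_group_add,t2_space} \<Rightarrow> real"
  assumes lc: "locally_compact_space (euclidean :: 'a topology)"
    and f: "continuous_on UNIV f" and K: "compact K" "\<And>x. x \<notin> K \<Longrightarrow> f x = 0" and e: "0 < e"
  obtains U where "open U" "0 \<in> U" "\<And>v x. v \<in> U \<Longrightarrow> \<bar>f (v + x) - f x\<bar> \<le> e"
proof -
  obtain U V :: "'a set" where UV: "open U" "compact V" "0 \<in> U" "U \<subseteq> V"
    using compact_nhds_zero[OF lc open_UNIV UNIV_I] by metis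
  \<comment> \<open>Outside \<open>D\<close> both values vanish: if \<open>v + x \<in> K\<close>
    with \<open>v \<in> V\<close>, then \<open>x\<close> lies in \<open>-V + K\<close>. Hence
    uniformity only has to be checked on a compact set.\<close>
  define D where "D = set_mult (uminus ` V) K \<union> K"
  have D: "compact D"
    using UV(2) K(1) by (simp add: D_def compact_Un compact_set_mult compact_uminus)
  have "continuous_on (UNIV \<times> D) (\<lambda>(v, x). f (v + x))"
    using f by (auto intro!: continuous_intros continuous_on_compose2[OF f] simp: case_prod_beta)
  then obtain X where X: "0 \<in> X" "open X" "\<forall>v\<in>X \<inter> UNIV. \<forall>x\<in>D. dist (f (v + x)) (f (0 + x)) \<le> e"
    by (rule continuous_on_prod_compactE[OF _ D UNIV_I[of 0] e]) simp
  show ?thesis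
  proof
    show "open (U \<inter> X)" "0 \<in> U \<inter> X" using UV X by auto
    fix v x assume v: "v \<in> U \<inter> X"
    show "\<bar>f (v + x) - f x\<bar> \<le> e"
    proof (cases "x \<in> D")
      case False
      moreover have "v + x \<notin> K"
      proof
        assume "v + x \<in> K"
        then have "- v + (v + x) \<in> set_mult (uminus ` V) K"
          using v UV by (intro set_mult_I) auto
        then show False using False by (simp add: D_def)
      qed
      ultimately show ?thesis using K(2) e by (auto simp: D_def)
    qed (use X v in \<open>auto simp: dist_real_def\<close>)
  qed
qed

text \<open>Needed so that the lemmas on Haar measures apply to the product measure and the lattice
  in it.\<close>

instance prod :: (topological_group_add, topological_group_add) topological_group_add
proof
  fix a b :: "'a \<times> 'b"
  have "((\<lambda>x. (fst (fst x) + fst (snd x), snd (fst x) + snd (snd x))) \<longlongrightarrow>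
      (fst a + fst b, snd a + snd b)) (nhds a \<times>\<^sub>F nhds b)"
    by (intro tendsto_Pair tendsto_add tendsto_fst tendsto_snd filterlim_fst filterlim_snd)
  then show "((\<lambda>x. fst x + snd x) \<longlongrightarrow> a + b) (nhds a \<times>\<^sub>F nhds b)"
    by (simp add: plus_prod_def)
  have "((\<lambda>x. (- fst x, - snd x)) \<longlongrightarrow> (- fst a, - snd a)) (nhds a)"
    by (intro tendsto_Pair tendsto_minus tendsto_fst tendsto_snd filterlim_ident)
  moreover have "(uminus :: 'a \<times> 'b \<Rightarrow> _) = (\<lambda>x. (- fst x, - snd x))"
    by (simp add: fun_eq_iff uminus_prod_def)
  ultimately show "(uminus \<longlongrightarrow> - a) (nhds a)"
    by (simp add: uminus_prod_def)
qed


section \<open>Haar measure and invariant functionals\<close>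

text \<open>Collects what follows from \<open>haar_measure\<close> alone, for use on both factors
  and on their product. Local compactness and unimodularity are added afterwards for the
  factors.\<close>

locale haar_group =
  fixes m :: "'a::{topological_group_add,t2_space} measure"
  assumes haar: "haar_measure m"
begin

lemma sets_haar [measurable_cong]: "sets m = sets borel"
  using haar by (simp add: haar_measure_def)

lemma space_haar [simp]: "space m = UNIV"
  using sets_eq_imp_space_eq[OF sets_haar] by simp

lemma compact_in_sets: "compact K \<Longrightarrow> K \<in> sets m"
  by (simp add: sets_haar borel_closed compact_imp_closed)

lemma open_in_sets: "open U \<Longrightarrow> U \<in> sets m"
  by (simp add: sets_haar)

lemma emeasure_compact_finite: "compact K \<Longrightarrow> emeasure m K < \<infinity>"
  using haar by (simp add: haar_measure_def)

lemma emeasure_subset_compact_finite: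
  assumes "A \<subseteq> K" "compact K"
  shows "emeasure m A \<noteq> \<infinity>"
proof -
  have "emeasure m A \<le> emeasure m K" by (rule emeasure_mono[OF assms(1) compact_in_sets[OF assms(2)]])
  also have "\<dots> < \<infinity>" by (rule emeasure_compact_finite[OF assms(2)])
  finally show ?thesis by simp
qed

lemma measure_mono_compact:
  assumes "compact A" "A \<subseteq> B" "compact B"
  shows "measure m A \<le> measure m B"
proof (rule measure_mono_fmeasurable)
  show "B \<in> fmeasurable m"
    using emeasure_compact_finite[OF assms(3)] compact_in_sets[OF assms(3)]
    by (intro fmeasurableI) (simp_all add: less_top)
qed (use assms compact_in_sets in auto)

lemma measure_pos:
  assumes "open U" "U \<noteq> {}" "U \<subseteq> K" "compact K"
  shows "0 < measure m K"
proof -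
  have "0 < emeasure m U" using haar assms(1,2) unfolding haar_measure_def by blast
  also have "\<dots> \<le> emeasure m K" using assms by (intro emeasure_mono compact_in_sets)
  finally show ?thesis
    using emeasure_compact_finite[OF assms(4)] by (simp add: measure_def enn2real_positive_iff less_top)
qed

lemma emeasure_translate: "A \<in> sets m \<Longrightarrow> emeasure m ((\<lambda>x. g + x) ` A) = emeasure m A"
  using haar by (simp add: haar_measure_def sets_haar)

lemma measurable_haar_iff: "f \<in> borel_measurable m \<longleftrightarrow> f \<in> borel_measurable borel"
  by (rule arg_cong[where f = "\<lambda>A. f \<in> A"], rule measurable_cong_sets) (auto simp: sets_haar)

lemma left_translate_measurable: "(\<lambda>x. g + x) \<in> measurable m m"
  using borel_measurable_continuous_onI[of "\<lambda>x::'a. g + x"]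
    measurable_cong_sets[OF sets_haar sets_haar] by (simp add: continuous_intros)

lemma right_translate_measurable: "(\<lambda>x. x + g) \<in> measurable m m"
  using borel_measurable_continuous_onI[of "\<lambda>x::'a. x + g"]
    measurable_cong_sets[OF sets_haar sets_haar] by (simp add: continuous_intros)

lemma distr_left_translate: "distr m m (\<lambda>x. g + x) = m"
proof (rule measure_eqI)
  fix A assume "A \<in> sets (distr m m (\<lambda>x. g + x))"
  then have A: "A \<in> sets m" by simp
  have "(\<lambda>x. g + x) -` A = (\<lambda>x. - g + x) ` A"
    by (auto simp: image_iff) (metis minus_add_cancel add_minus_cancel)
  then show "emeasure (distr m m (\<lambda>x. g + x)) A = emeasure m A"
    using emeasure_translate[OF A, of "- g"] A
    by (simp add: emeasure_distr[OF left_translate_measurable])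
qed simp

lemma integral_left_translate:
  fixes f :: "'a \<Rightarrow> real"
  assumes "f \<in> borel_measurable borel"
  shows "(\<integral>x. f (g + x) \<partial>m) = (\<integral>x. f x \<partial>m)"
proof -
  have "(\<integral>x. f x \<partial>m) = (\<integral>x. f x \<partial>distr m m (\<lambda>x. g + x))"
    by (simp only: distr_left_translate)
  also have "\<dots> = (\<integral>x. f (g + x) \<partial>m)"
    by (rule integral_distr[OF left_translate_measurable]) (use assms in \<open>simp add: measurable_haar_iff\<close>)
  finally show ?thesis ..
qed

lemma integrable_compact_support:
  fixes f :: "'a \<Rightarrow> real"
  assumes "f \<in> borel_measurable borel" "compact C" "\<And>x. x \<notin> C \<Longrightarrow> f x = 0" "\<And>x. \<bar>f x\<bar> \<le> c"
  shows "integrable m f"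
proof (rule Bochner_Integration.integrable_bound)
  show "integrable m (\<lambda>x. c * indicator C x :: real)"
    using assms(2) emeasure_compact_finite
    by (intro integrable_mult_right integrable_real_indicator) (auto simp: compact_in_sets)
  show "AE x in m. norm (f x) \<le> norm (c * indicator C x :: real)"
  proof (rule AE_I2)
    fix x show "norm (f x) \<le> norm (c * indicator C x :: real)"
      using assms(3)[of x] assms(4)[of x] by (cases "x \<in> C") auto
  qed
qed (use assms(1) in \<open>simp add: measurable_haar_iff\<close>)

text \<open>The step function with value \<open>c i\<close> on \<open>E i\<close> is within
  \<open>\<beta>\<close> of \<open>h\<close> on \<open>C\<close> and agrees with it elsewhere. The
  partition is given in advance so that a single one serves a whole family of functions
  \<open>h\<close>.\<close>

lemma step_approximation:
  fixes h :: "'a \<Rightarrow> real" and n :: nat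
  assumes C: "compact C" and E: "\<And>i. i < n \<Longrightarrow> E i \<in> sets m" "disjoint_family_on E {..<n}" "C = (\<Union>i<n. E i)"
    and h: "integrable m h" "\<And>y. y \<notin> C \<Longrightarrow> h y = 0"
    and approx: "\<And>i y. i < n \<Longrightarrow> y \<in> E i \<Longrightarrow> \<bar>h y - c i\<bar> \<le> \<beta>"
  shows "\<bar>(\<integral>y. h y \<partial>m) - (\<Sum>i<n. measure m (E i) * c i)\<bar> \<le> \<beta> * measure m C"
proof -
  define s where "s y = (\<Sum>i<n. indicator (E i) y * c i)" for y
  have EC: "E i \<subseteq> C" if "i < n" for i using E(3) that by blast
  have fin: "emeasure m (E i) < \<infinity>" if "i < n" for i
    using emeasure_subset_compact_finite[OF EC[OF that] C] by (simp add: less_top)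
  have int_i: "integrable m (\<lambda>y. indicator (E i) y * c i)" if "i < n" for i
    using E(1)[OF that] fin[OF that] by (intro integrable_mult_left integrable_real_indicator)
  then have s: "integrable m s"
    unfolding s_def[abs_def] by (intro Bochner_Integration.integrable_sum) auto
  have "(\<integral>y. s y \<partial>m) = (\<Sum>i<n. (\<integral>y. indicator (E i) y * c i \<partial>m))"
    unfolding s_def by (rule Bochner_Integration.integral_sum) (use int_i in auto)
  also have "\<dots> = (\<Sum>i<n. measure m (E i) * c i)"
    by (intro sum.cong refl) (use E(1) in auto)
  finally have ints: "(\<integral>y. s y \<partial>m) = (\<Sum>i<n. measure m (E i) * c i)" .
  have "\<bar>h y - s y\<bar> \<le> \<beta> * indicator C y" for y
  proof (cases "y \<in> C")
    case True
    then obtain i where i: "i < n" "y \<in> E i" using E(3) by auto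
    have "indicator (E j) y * c j = (if j = i then c i else 0)" if "j < n" for j
      using i that E(2) by (auto simp: disjoint_family_on_def indicator_def)
    then have "s y = (\<Sum>j<n. if j = i then c i else 0)" unfolding s_def by (intro sum.cong) auto
    also have "\<dots> = c i" using i(1) by simp
    finally have "s y = c i" .
    then show ?thesis using approx[OF i] True by simp
  next
    case False
    then have "s y = 0" unfolding s_def using EC by (intro sum.neutral) (auto simp: indicator_def)
    then show ?thesis using h(2) False by simp
  qed
  moreover have "integrable m (\<lambda>y. \<beta> * indicator C y)"
    using C emeasure_compact_finite by (intro integrable_mult_right integrable_real_indicator) (auto simp: compact_in_sets)
  ultimately have "(\<integral>y. \<bar>h y - s y\<bar> \<partial>m) \<le> (\<integral>y. \<beta> * indicator C y \<partial>m)"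
    using h(1) s by (intro integral_mono) auto
  also have "\<dots> = \<beta> * measure m C" using C compact_in_sets by simp
  finally have "(\<integral>y. \<bar>h y - s y\<bar> \<partial>m) \<le> \<beta> * measure m C" .
  moreover have "\<bar>\<integral>y. h y - s y \<partial>m\<bar> \<le> (\<integral>y. \<bar>h y - s y\<bar> \<partial>m)"
    using integral_abs_bound[of m "\<lambda>y. h y - s y"] by simp
  moreover have "(\<integral>y. h y - s y \<partial>m) = (\<integral>y. h y \<partial>m) - (\<integral>y. s y \<partial>m)"
    using h s by (intro Bochner_Integration.integral_diff)
  ultimately show ?thesis using ints by linarith
qed

end

section \<open>Invariant functionals on functions dominated by a fixed function\<close>

definition dominated :: "('b::topological_space \<Rightarrow> real) \<Rightarrow> ('b \<Rightarrow> real) set" where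
  "dominated b = {f \<in> borel_measurable borel. \<exists>c. \<forall>x. \<bar>f x\<bar> \<le> c * b x}"

lemma dominatedI: "f \<in> borel_measurable borel \<Longrightarrow> (\<And>x. \<bar>f x\<bar> \<le> c * b x) \<Longrightarrow> f \<in> dominated b"
  by (auto simp: dominated_def)

lemma dominated_lin:
  assumes f: "f \<in> dominated b" and g: "g \<in> dominated b"
  shows "(\<lambda>x. s * f x + t * g x) \<in> dominated b"
proof -
  obtain c where c: "\<And>x. \<bar>f x\<bar> \<le> c * b x" using f by (auto simp: dominated_def)
  obtain d where d: "\<And>x. \<bar>g x\<bar> \<le> d * b x" using g by (auto simp: dominated_def)
  have "\<bar>s * f x + t * g x\<bar> \<le> (\<bar>s\<bar> * c + \<bar>t\<bar> * d) * b x" for x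
  proof -
    have "\<bar>s * f x + t * g x\<bar> \<le> \<bar>s\<bar> * \<bar>f x\<bar> + \<bar>t\<bar> * \<bar>g x\<bar>"
      using abs_triangle_ineq[of "s * f x" "t * g x"] by (simp add: abs_mult)
    also have "\<dots> \<le> \<bar>s\<bar> * (c * b x) + \<bar>t\<bar> * (d * b x)"
      by (intro add_mono mult_left_mono c d) auto
    finally show ?thesis by (simp add: algebra_simps)
  qed
  then show ?thesis using f g by (intro dominatedI) (auto simp: dominated_def)
qed

text \<open>Covers both the Haar integral (\<open>b\<close> the indicator of a compact set) and an invariant mean
  (\<open>b\<close> constant).\<close>

locale dominated_functional =
  fixes M :: "('b::{topological_space,group_add} \<Rightarrow> real) \<Rightarrow> real" and b :: "'b \<Rightarrow> real" and B :: real
  assumes b_nonneg: "0 \<le> b x"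
    and lin: "f \<in> dominated b \<Longrightarrow> g \<in> dominated b \<Longrightarrow> M (\<lambda>x. s * f x + t * g x) = s * M f + t * M g"
    and bound: "f \<in> dominated b \<Longrightarrow> 0 \<le> e \<Longrightarrow> (\<And>x. \<bar>f x\<bar> \<le> e * b x) \<Longrightarrow> \<bar>M f\<bar> \<le> e * B"
    and left_invariant: "f \<in> dominated b \<Longrightarrow> (\<lambda>x. f (y + x)) \<in> dominated b \<Longrightarrow> M (\<lambda>x. f (y + x)) = M f"
begin

lemma zero_dominated: "(\<lambda>_. 0) \<in> dominated b"
  by (rule dominatedI[of _ 0]) auto

lemma B_nonneg: "0 \<le> B"
  using bound[OF zero_dominated, of 1] b_nonneg by simp

lemma lin_sum:
  assumes "finite I" "\<And>i. i \<in> I \<Longrightarrow> f i \<in> dominated b"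
  shows "(\<lambda>x. \<Sum>i\<in>I. a i * f i x) \<in> dominated b \<and> M (\<lambda>x. \<Sum>i\<in>I. a i * f i x) = (\<Sum>i\<in>I. a i * M (f i))"
  using assms
proof (induction I)
  case empty
  have "M (\<lambda>_. 0) = 0" using bound[OF zero_dominated, of 0] by simp
  then show ?case using zero_dominated by simp
next
  case (insert i I)
  then show ?case
    using dominated_lin[of "f i" b "\<lambda>x. \<Sum>i\<in>I. a i * f i x" "a i" 1]
      lin[of "f i" "\<lambda>x. \<Sum>i\<in>I. a i * f i x" "a i" 1]
    by simp
qed

lemma diff:
  assumes "f \<in> dominated b" "g \<in> dominated b"
  shows "(\<lambda>x. f x - g x) \<in> dominated b" "M (\<lambda>x. f x - g x) = M f - M g"
proof -
  have eq: "(\<lambda>x. f x - g x) = (\<lambda>x. 1 * f x + (- 1) * g x)" by auto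
  show "(\<lambda>x. f x - g x) \<in> dominated b" unfolding eq by (rule dominated_lin[OF assms])
  show "M (\<lambda>x. f x - g x) = M f - M g" unfolding eq by (subst lin[OF assms]) simp
qed

end

text \<open>Riemann sums replace Fubini: \<open>M\<close> is only finitely additive, and without second
  countability the Borel sets of the product need not lie in the product sigma algebra.\<close>

lemma (in haar_group) functional_integral_swap:
  fixes M :: "('b::{topological_space,group_add} \<Rightarrow> real) \<Rightarrow> real"
  assumes "dominated_functional M b B" and C: "compact C"
    and dom: "\<And>y. \<Phi> y \<in> dominated b" and supp: "\<And>y x. y \<notin> C \<Longrightarrow> \<Phi> y x = 0"
    and cont: "\<And>y e. 0 < e \<Longrightarrow> \<exists>U. open U \<and> y \<in> U \<and> (\<forall>y'\<in>U. \<forall>x. \<bar>\<Phi> y' x - \<Phi> y x\<bar> \<le> e * b x)"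
    and int: "\<And>x. integrable m (\<lambda>y. \<Phi> y x)"
    and dom_int: "(\<lambda>x. \<integral>y. \<Phi> y x \<partial>m) \<in> dominated b"
  shows "M (\<lambda>x. \<integral>y. \<Phi> y x \<partial>m) = (\<integral>y. M (\<Phi> y) \<partial>m)"
proof -
  interpret M: dominated_functional M b B by fact
  have contM: "\<bar>M (\<Phi> y') - M (\<Phi> y)\<bar> \<le> e * B"
    if "0 \<le> e" "\<And>x. \<bar>\<Phi> y' x - \<Phi> y x\<bar> \<le> e * b x" for y y' e
    using M.bound[OF M.diff(1)[OF dom dom] that] M.diff(2)[OF dom dom] by metis
  have M0: "M (\<Phi> y) = 0" if "y \<notin> C" for y
    using M.bound[OF dom, of 0 y] supp[OF that] by simp
  have "continuous_on UNIV (\<lambda>y. M (\<Phi> y))"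
  proof (clarsimp simp: continuous_on_eq_continuous_at isCont_def)
    fix y show "((\<lambda>y. M (\<Phi> y)) \<longlongrightarrow> M (\<Phi> y)) (at y)"
    proof (rule tendstoI)
      fix e :: real assume e: "0 < e"
      \<comment> \<open>The added 1 keeps the denominator positive when
        \<open>B = 0\<close>.\<close>
      define d where "d = e / (2 * (B + 1))"
      have d: "0 < d" "d * B < e"
        using e M.B_nonneg by (auto simp: d_def field_simps intro!: add_nonneg_pos)
      obtain U where U: "open U" "y \<in> U" "\<And>y' x. y' \<in> U \<Longrightarrow> \<bar>\<Phi> y' x - \<Phi> y x\<bar> \<le> d * b x"
        using cont[OF d(1), of y] by blast
      have "dist (M (\<Phi> y')) (M (\<Phi> y)) < e" if "y' \<in> U" for y'
        using contM[of d y' y] U(3)[OF that] d by (simp add: dist_real_def)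
      then show "\<forall>\<^sub>F y' in at y. dist (M (\<Phi> y')) (M (\<Phi> y)) < e"
        unfolding eventually_at_topological using U by blast
    qed
  qed
  then have meas: "(\<lambda>y. M (\<Phi> y)) \<in> borel_measurable borel"
    and "compact ((\<lambda>y. M (\<Phi> y)) ` C)"
    by (auto intro: borel_measurable_continuous_onI compact_continuous_image continuous_on_subset C)
  then obtain c where c: "\<And>y. y \<in> C \<Longrightarrow> \<bar>M (\<Phi> y)\<bar> \<le> c"
    using compact_imp_bounded by (fastforce simp: bounded_iff)
  have "\<bar>M (\<Phi> y)\<bar> \<le> max c 0" for y using c[of y] M0[of y] by (cases "y \<in> C") auto
  then have intM: "integrable m (\<lambda>y. M (\<Phi> y))"
    using meas C M0 by (intro integrable_compact_support)
  have est: "\<bar>M (\<lambda>x. \<integral>y. \<Phi> y x \<partial>m) - (\<integral>y. M (\<Phi> y) \<partial>m)\<bar> \<le> e * (2 * measure m C * B)"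
    if e: "0 < e" for e
  proof -
    obtain U where U: "\<And>y. open (U y)" "\<And>y. y \<in> U y"
      "\<And>y y' x. y' \<in> U y \<Longrightarrow> \<bar>\<Phi> y' x - \<Phi> y x\<bar> \<le> e * b x"
      using cont[OF e] by metis
    obtain Y where Y: "Y \<subseteq> C" "finite Y" "C \<subseteq> (\<Union>y\<in>Y. U y)"
      using compactE_image[OF C, of C U] U by (metis UN_I subsetI)
    obtain ys where ys: "set ys = Y" using finite_list[OF Y(2)] by blast
    define n where "n = length ys"
    \<comment> \<open>The finite cover is made disjoint by assigning each point of \<open>C\<close>
      to the first \<open>U\<close> that contains it. On \<open>E i\<close> the function
      \<open>\<Phi> y\<close> stays within \<open>e * b\<close> of \<open>\<Phi> (ys ! i)\<close>,
      for all \<open>x\<close> at once.\<close>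
    define E where "E i = C \<inter> (U (ys ! i) - (\<Union>j<i. U (ys ! j)))" for i
    have E1: "E i \<in> sets m" for i
      unfolding E_def by (intro sets.Int sets.Diff sets.finite_UN) (auto intro: compact_in_sets open_in_sets C U)
    have E2: "disjoint_family_on E {..<n}"
      unfolding disjoint_family_on_def
    proof (intro ballI impI)
      fix i j :: nat assume "i \<noteq> j"
      then show "E i \<inter> E j = {}" by (cases "i < j") (auto simp: E_def)
    qed
    have E3: "C = (\<Union>i<n. E i)"
    proof (intro equalityI subsetI)
      fix y assume y: "y \<in> C"
      then obtain t where "t \<in> set ys" "y \<in> U t" using Y(3) ys by blast
      then have ex: "\<exists>i. i < n \<and> y \<in> U (ys ! i)"
        by (auto simp: in_set_conv_nth n_def)
      define i where "i = (LEAST i. i < n \<and> y \<in> U (ys ! i))"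
      have "i < n \<and> y \<in> U (ys ! i)" unfolding i_def by (rule LeastI_ex[OF ex])
      moreover have "y \<notin> U (ys ! j)" if "j < i" for j
        using not_less_Least[OF that[unfolded i_def]] that calculation by auto
      ultimately show "y \<in> (\<Union>i<n. E i)" using y by (auto simp: E_def)
    qed (auto simp: E_def)
    have close: "\<bar>\<Phi> y x - \<Phi> (ys ! i) x\<bar> \<le> e * b x" if "i < n" "y \<in> E i" for i y x
      using that U(3) by (auto simp: E_def)
    \<comment> \<open>One Riemann sum links both sides: \<open>s\<close> approximates the integral
      of \<open>\<Phi> y x\<close> at every \<open>x\<close>, and by linearity \<open>M s\<close> is
      a Riemann sum for the integral of \<open>M (\<Phi> y)\<close>.\<close>
    define s where "s x = (\<Sum>i<n. measure m (E i) * \<Phi> (ys ! i) x)" for x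
    have s: "s \<in> dominated b" "M s = (\<Sum>i<n. measure m (E i) * M (\<Phi> (ys ! i)))"
      using M.lin_sum[of "{..<n}" "\<lambda>i. \<Phi> (ys ! i)" "\<lambda>i. measure m (E i)"] dom by (auto simp: s_def[abs_def])
    have "\<bar>(\<integral>y. \<Phi> y x \<partial>m) - s x\<bar> \<le> e * b x * measure m C" for x
      unfolding s_def by (rule step_approximation[OF C E1 E2 E3 int]) (use supp close in auto)
    then have "\<bar>M (\<lambda>x. \<integral>y. \<Phi> y x \<partial>m) - M s\<bar> \<le> e * measure m C * B"
      using M.bound[OF M.diff(1)[OF dom_int s(1)], of "e * measure m C"] e M.diff(2)[OF dom_int s(1)]
      by (simp add: mult_ac)
    moreover have "\<bar>(\<integral>y. M (\<Phi> y) \<partial>m) - M s\<bar> \<le> e * B * measure m C"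
      unfolding s(2) by (rule step_approximation[OF C E1 E2 E3 intM]) (use M0 contM close e in auto)
    ultimately show ?thesis by (simp add: algebra_simps)
  qed
  have "\<bar>M (\<lambda>x. \<integral>y. \<Phi> y x \<partial>m) - (\<integral>y. M (\<Phi> y) \<partial>m)\<bar> \<le> 0 + e" if "0 < e" for e :: real
  proof -
    define k where "k = 2 * measure m C * B"
    have k: "0 \<le> k" using M.B_nonneg by (simp add: k_def)
    have "e / (k + 1) * k \<le> e" using k that by (simp add: field_simps)
    then show ?thesis using est[of "e / (k + 1)"] k that unfolding k_def[symmetric] by simp
  qed
  from field_le_epsilon[OF this] show ?thesis by simp
qed


text \<open>The index set varies with \<open>g\<close>, so the sum is obtained as a limit of partial
  sums along an enumeration of \<open>X\<close>. At each \<open>g\<close> these are eventually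
  constant.\<close>

lemma borel_measurable_locally_finite_sum:
  fixes h :: "'i \<Rightarrow> 'b::topological_space \<Rightarrow> real"
  assumes X: "countable X" "\<And>g. finite {x \<in> X. P x g}"
    and P: "\<And>x. x \<in> X \<Longrightarrow> {g. P x g} \<in> sets borel"
    and h: "\<And>x. x \<in> X \<Longrightarrow> h x \<in> borel_measurable borel"
  shows "(\<lambda>g. \<Sum>x\<in>{x \<in> X. P x g}. h x g) \<in> borel_measurable borel"
proof (cases "X = {}")
  case False
  define u where "u n g = (\<Sum>x\<in>from_nat_into X ` {..<n}. if P x g then h x g else 0)" for n :: nat and g
  have X': "from_nat_into X ` {..<n} \<subseteq> X" for n using from_nat_into[OF False] by blast
  show ?thesis
  proof (rule borel_measurable_LIMSEQ_real)
    show "u n \<in> borel_measurable borel" for n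
      unfolding u_def[abs_def]
      by (intro borel_measurable_sum measurable_If) (use X' P h in \<open>auto simp: pred_def\<close>)
    fix g
    obtain n where n: "{x \<in> X. P x g} \<subseteq> from_nat_into X ` {..<n}"
    proof -
      obtain n where n: "\<And>i. i \<in> to_nat_on X ` {x \<in> X. P x g} \<Longrightarrow> i < n"
        using X(2)[of g] finite_nat_set_iff_bounded[of "to_nat_on X ` {x \<in> X. P x g}"] by auto
      have "x \<in> from_nat_into X ` {..<n}" if "x \<in> X" "P x g" for x
        using n[of "to_nat_on X x"] that X(1) by (intro image_eqI[of _ _ "to_nat_on X x"]) auto
      then show ?thesis using that by blast
    qed
    have "u k g = (\<Sum>x\<in>{x \<in> X. P x g}. h x g)" if "n \<le> k" for k
    proof -
      have "from_nat_into X ` {..<n} \<subseteq> from_nat_into X ` {..<k}" using that by auto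
      then have "u k g = (\<Sum>x\<in>{x \<in> X. P x g}. if P x g then h x g else 0)"
        unfolding u_def using n from_nat_into[OF False] by (intro sum.mono_neutral_right) auto
      then show ?thesis by simp
    qed
    then have "\<forall>\<^sub>F k in sequentially. u k g = (\<Sum>x\<in>{x \<in> X. P x g}. h x g)"
      by (rule eventually_sequentiallyI)
    then show "(\<lambda>k. u k g) \<longlonglongrightarrow> (\<Sum>x\<in>{x \<in> X. P x g}. h x g)"
      by (rule tendsto_eventually)
  qed
qed simp

lemma continuous_compact_support_bounded:
  fixes f :: "'a::topological_space \<Rightarrow> real"
  assumes "continuous_on UNIV f" "compact D" "\<And>x. x \<notin> D \<Longrightarrow> f x = 0"
  obtains c where "0 \<le> c" "\<And>x. \<bar>f x\<bar> \<le> c"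
proof -
  have "compact (f ` D)" 
    by (rule compact_continuous_image[OF continuous_on_subset[OF assms(1) subset_UNIV] assms(2)])
  then obtain c where c: "\<And>x. x \<in> D \<Longrightarrow> \<bar>f x\<bar> \<le> c"
    using compact_imp_bounded by (fastforce simp: bounded_iff)
  have "\<bar>f x\<bar> \<le> max c 0" for x using c[of x] assms(3)[of x] by (cases "x \<in> D") auto
  then show ?thesis using that[of "max c 0"] by simp
qed

section \<open>Sums over the points of a countable set seen from a moving point through a compact
  set\<close>

context
  fixes X D :: "'a::{topological_group_add,t2_space} set" and b :: "'a \<Rightarrow> real"
  assumes X: "countable X" "\<And>g. finite {x \<in> X. g - x \<in> D}" and D: "compact D"
    and card_le: "\<And>g. real (card {x \<in> X. g - x \<in> D}) \<le> b g"
begin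

lemma abs_sum_le_card_mult:
  fixes h :: "'a \<Rightarrow> 'a \<Rightarrow> real"
  assumes "\<And>x. x \<in> X \<Longrightarrow> \<bar>h x g\<bar> \<le> c" "0 \<le> c"
  shows "\<bar>\<Sum>x\<in>{x \<in> X. g - x \<in> D}. h x g\<bar> \<le> c * b g"
proof -
  have "\<bar>\<Sum>x\<in>{x \<in> X. g - x \<in> D}. h x g\<bar> \<le> (\<Sum>x\<in>{x \<in> X. g - x \<in> D}. \<bar>h x g\<bar>)"
    by (rule sum_abs)
  also have "\<dots> \<le> (\<Sum>x\<in>{x \<in> X. g - x \<in> D}. c)" by (rule sum_mono) (use assms in auto)
  also have "\<dots> = c * real (card {x \<in> X. g - x \<in> D})" by simp
  also have "\<dots> \<le> c * b g" by (rule mult_left_mono[OF card_le assms(2)])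
  finally show ?thesis .
qed

lemma locally_finite_sum_dominated:
  fixes h :: "'a \<Rightarrow> 'a \<Rightarrow> real"
  assumes "\<And>x. x \<in> X \<Longrightarrow> continuous_on UNIV (h x)" "\<And>x g. x \<in> X \<Longrightarrow> \<bar>h x g\<bar> \<le> c" "0 \<le> c"
  shows "(\<lambda>g. \<Sum>x\<in>{x \<in> X. g - x \<in> D}. h x g) \<in> dominated b"
proof (rule dominatedI)
  have "{g. g - x \<in> D} \<in> sets borel" for x
  proof -
    have "closed ((\<lambda>g. g - x) -` D)"
      by (intro closed_vimage compact_imp_closed D continuous_intros)
    then show ?thesis by (simp add: vimage_def)
  qed
  then show "(\<lambda>g. \<Sum>x\<in>{x \<in> X. g - x \<in> D}. h x g) \<in> borel_measurable borel"
    using X assms(1) by (intro borel_measurable_locally_finite_sum borel_measurable_continuous_onI)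
  show "\<bar>\<Sum>x\<in>{x \<in> X. g - x \<in> D}. h x g\<bar> \<le> c * b g" for g
    by (rule abs_sum_le_card_mult) (use assms in auto)
qed

text \<open>By \<open>const\<close> every summand integrates over \<open>y\<close> to
  \<open>a x g\<close> times the same \<open>c\<close>, so the integral of the sum is
  \<open>c\<close> times the sum of the \<open>a x g\<close>; the swap then moves \<open>M\<close>
  inside. It is used with \<open>\<sigma>\<close> the identity and with \<open>\<sigma>\<close> the
  inversion.\<close>

lemma functional_integral_swap_sum:
  fixes M :: "('a \<Rightarrow> real) \<Rightarrow> real" and m :: "'a measure" and \<theta> :: "'a \<Rightarrow> real" and \<sigma> :: "'a \<Rightarrow> 'a"
  assumes m: "haar_group m" and M: "dominated_functional M b B"
    and lc: "locally_compact_space (euclidean :: 'a topology)"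
    and \<theta>: "continuous_on UNIV \<theta>" "compact D'" "\<And>x. x \<notin> D' \<Longrightarrow> \<theta> x = 0"
    and \<sigma>: "continuous_on UNIV \<sigma>"
    and a: "\<And>x. x \<in> X \<Longrightarrow> continuous_on UNIV (a x)" "\<And>x g. x \<in> X \<Longrightarrow> \<bar>a x g\<bar> \<le> A" "0 \<le> A"
    and r: "\<And>x. x \<in> X \<Longrightarrow> continuous_on UNIV (r x)"
    and C: "compact C" "\<And>x y g. x \<in> X \<Longrightarrow> g - x \<in> D \<Longrightarrow> y \<notin> C \<Longrightarrow> a x g * \<theta> (\<sigma> y + r x g) = 0"
    and const: "\<And>x g. x \<in> X \<Longrightarrow> (\<integral>y. \<theta> (\<sigma> y + r x g) \<partial>m) = c"
  shows "c * M (\<lambda>g. \<Sum>x\<in>{x \<in> X. g - x \<in> D}. a x g)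
    = (\<integral>y. M (\<lambda>g. \<Sum>x\<in>{x \<in> X. g - x \<in> D}. a x g * \<theta> (\<sigma> y + r x g)) \<partial>m)"
proof -
  interpret haar_group m by fact
  interpret M: dominated_functional M b B by fact
  obtain T where T: "0 \<le> T" "\<And>x. \<bar>\<theta> x\<bar> \<le> T"
    using continuous_compact_support_bounded[OF \<theta>] by blast
  define \<Phi> where "\<Phi> y g = (\<Sum>x\<in>{x \<in> X. g - x \<in> D}. a x g * \<theta> (\<sigma> y + r x g))" for y g
  have bd: "\<bar>a x g * \<theta> z\<bar> \<le> A * T" if "x \<in> X" for x g z
    unfolding abs_mult using a(2)[OF that] T a(3) by (intro mult_mono) auto
  have cont_g: "continuous_on UNIV (\<lambda>g. a x g * \<theta> (\<sigma> y + r x g))" if "x \<in> X" for x y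
    using a(1)[OF that] r[OF that]
    by (intro continuous_on_mult continuous_on_compose2[OF \<theta>(1)] continuous_on_add continuous_on_const) auto
  have cont_y: "continuous_on UNIV (\<lambda>y. a x g * \<theta> (\<sigma> y + r x g))" for x g
    using \<sigma>
    by (intro continuous_on_mult continuous_on_compose2[OF \<theta>(1)] continuous_on_add continuous_on_const) auto
  have dom: "\<Phi> y \<in> dominated b" for y
    unfolding \<Phi>_def[abs_def] using cont_g bd a(3) T(1) by (intro locally_finite_sum_dominated[where c = "A * T"]) auto
  have doma: "(\<lambda>g. \<Sum>x\<in>{x \<in> X. g - x \<in> D}. a x g) \<in> dominated b"
    using a by (rule locally_finite_sum_dominated)
  have int_term: "integrable m (\<lambda>y. a x g * \<theta> (\<sigma> y + r x g))" if "x \<in> X" "g - x \<in> D" for x g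
    using C that bd cont_y
    by (intro integrable_compact_support[where C = C and c = "A * T"] borel_measurable_continuous_onI) auto
  have int: "integrable m (\<lambda>y. \<Phi> y g)" for g
    unfolding \<Phi>_def by (intro Bochner_Integration.integrable_sum int_term) auto
  have int_eq: "(\<integral>y. \<Phi> y g \<partial>m) = c * (\<Sum>x\<in>{x \<in> X. g - x \<in> D}. a x g)" for g
  proof -
    have "(\<integral>y. \<Phi> y g \<partial>m) = (\<Sum>x\<in>{x \<in> X. g - x \<in> D}. (\<integral>y. a x g * \<theta> (\<sigma> y + r x g) \<partial>m))"
      unfolding \<Phi>_def by (rule Bochner_Integration.integral_sum) (use int_term in auto)
    also have "\<dots> = (\<Sum>x\<in>{x \<in> X. g - x \<in> D}. c * a x g)"
      by (intro sum.cong refl) (use const in auto)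
    finally show ?thesis by (simp add: sum_distrib_left)
  qed
  have cont: "\<exists>U. open U \<and> y \<in> U \<and> (\<forall>y'\<in>U. \<forall>g. \<bar>\<Phi> y' g - \<Phi> y g\<bar> \<le> e * b g)" if e: "0 < e" for y e
  proof -
    define d where "d = e / (A + 1)"
    have d: "0 < d" "A * d \<le> e" using e a(3) by (auto simp: d_def field_simps)
    obtain U where U: "open U" "0 \<in> U" "\<And>v x. v \<in> U \<Longrightarrow> \<bar>\<theta> (v + x) - \<theta> x\<bar> \<le> d"
      using compact_support_uniformly_continuous[OF lc \<theta> d(1)] by metis
    \<comment> \<open>Passing from \<open>y\<close> to \<open>y'\<close> translates every argument
      of \<open>\<theta>\<close> on the left by the same element
      \<open>\<sigma> y' - \<sigma> y\<close>. Uniform continuity therefore gives one estimate for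
      all \<open>x\<close> and \<open>g\<close>.\<close>
    have "open ((\<lambda>y'. \<sigma> y' - \<sigma> y) -` U)"
      using \<sigma> by (intro open_vimage U continuous_intros)
    moreover have "\<bar>\<Phi> y' g - \<Phi> y g\<bar> \<le> e * b g" if y': "\<sigma> y' - \<sigma> y \<in> U" for y' g
    proof -
      have "\<bar>\<theta> (\<sigma> y' + z) - \<theta> (\<sigma> y + z)\<bar> \<le> d" for z
        using U(3)[OF y', of "\<sigma> y + z"] by (simp add: add.assoc[symmetric])
      then have "\<bar>a x g * (\<theta> (\<sigma> y' + r x g) - \<theta> (\<sigma> y + r x g))\<bar> \<le> A * d" if "x \<in> X" for x
        unfolding abs_mult using a(2)[OF that] a(3) by (intro mult_mono) auto
      then have "\<bar>\<Sum>x\<in>{x \<in> X. g - x \<in> D}. a x g * (\<theta> (\<sigma> y' + r x g) - \<theta> (\<sigma> y + r x g))\<bar> \<le> e * b g"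
        using d e by (intro abs_sum_le_card_mult) (auto intro: order_trans)
      then show ?thesis by (simp add: \<Phi>_def sum_subtractf right_diff_distrib)
    qed
    ultimately show ?thesis using U(2) by (intro exI[of _ "(\<lambda>y'. \<sigma> y' - \<sigma> y) -` U"]) auto
  qed
  have supp: "\<Phi> y g = 0" if "y \<notin> C" for y g
    unfolding \<Phi>_def using C(2) that by (intro sum.neutral) auto
  have domc: "(\<lambda>g. \<integral>y. \<Phi> y g \<partial>m) \<in> dominated b"
    using dominated_lin[OF doma doma, of c 0] by (simp add: int_eq)
  have "(\<integral>y. M (\<Phi> y) \<partial>m) = M (\<lambda>g. \<integral>y. \<Phi> y g \<partial>m)"
    using functional_integral_swap[OF M C(1) dom supp cont int domc] by simp
  also have "\<dots> = c * M (\<lambda>g. \<Sum>x\<in>{x \<in> X. g - x \<in> D}. a x g)"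
    using M.lin[OF doma doma, of c 0] by (simp add: int_eq)
  finally show ?thesis by (simp add: \<Phi>_def[abs_def])
qed

end

section \<open>Unimodular groups and the translation identity\<close>

locale unimodular_haar_group = haar_group m
  for m :: "'a::{topological_group_add,t2_space} measure" +
  assumes lc: "locally_compact_space (euclidean :: 'a topology)" and unimod: "unimodular m"
begin

lemma distr_right_translate: "distr m m (\<lambda>x. x + g) = m"
proof (rule measure_eqI)
  fix A assume "A \<in> sets (distr m m (\<lambda>x. x + g))"
  then have A: "A \<in> sets borel" by (simp add: sets_haar)
  have "(\<lambda>x. x + g) -` A = (\<lambda>x. x + - g) ` A"
    by (auto simp: image_iff) (metis add_diff_cancel)
  then show "emeasure (distr m m (\<lambda>x. x + g)) A = emeasure m A"
    using unimod[unfolded unimodular_def, rule_format, OF A, of "- g"] A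
    by (simp add: emeasure_distr[OF right_translate_measurable] sets_haar)
qed simp

lemma integral_right_translate:
  fixes f :: "'a \<Rightarrow> real"
  assumes "f \<in> borel_measurable borel"
  shows "(\<integral>x. f (x + g) \<partial>m) = (\<integral>x. f x \<partial>m)"
proof -
  have "(\<integral>x. f x \<partial>m) = (\<integral>x. f x \<partial>distr m m (\<lambda>x. x + g))"
    by (simp only: distr_right_translate)
  also have "\<dots> = (\<integral>x. f (x + g) \<partial>m)"
    by (rule integral_distr[OF right_translate_measurable]) (use assms in \<open>simp add: measurable_haar_iff\<close>)
  finally show ?thesis ..
qed

text \<open>Integrate \<open>\<psi> (g - \<phi> x) * \<eta> (y + g - x)\<close> over \<open>y\<close>, sum over \<open>x\<close>, and apply \<open>M\<close> in \<open>g\<close>; then do the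
  same after replacing \<open>g\<close> by \<open>- y + g\<close>.  With \<open>X = {0}\<close> and \<open>M\<close> the Haar integral this yields
  invariance under inversion.\<close>

lemma functional_translation_identity:
  assumes M: "dominated_functional M b B"
    and X: "countable X" "\<And>g. finite {x \<in> X. g - x \<in> D}" and D: "D = D0 \<union> set_mult D0 K"
    and card_le: "\<And>g. real (card {x \<in> X. g - x \<in> D}) \<le> b g"
    and K: "compact K" "\<And>x. x \<in> X \<Longrightarrow> \<phi> x - x \<in> K"
    and D0: "compact D0"
    and \<psi>: "continuous_on UNIV \<psi>" "\<And>x. x \<notin> D0 \<Longrightarrow> \<psi> x = 0"
    and \<eta>: "continuous_on UNIV \<eta>" "\<And>x. x \<notin> D0 \<Longrightarrow> \<eta> x = 0"
  shows "(\<integral>y. \<eta> y \<partial>m) * M (\<lambda>g. \<Sum>x\<in>{x \<in> X. g - x \<in> D}. \<psi> (g - \<phi> x))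
    = (\<integral>y. \<psi> (- y) \<partial>m) * M (\<lambda>g. \<Sum>x\<in>{x \<in> X. g - x \<in> D}. \<eta> (g - x))"
proof -
  interpret M: dominated_functional M b B by fact
  have cD: "compact D" unfolding D by (intro compact_Un compact_set_mult D0 K(1))
  obtain A1 where A1: "0 \<le> A1" "\<And>x. \<bar>\<psi> x\<bar> \<le> A1"
    using continuous_compact_support_bounded[OF \<psi>(1) D0 \<psi>(2)] by blast
  obtain A2 where A2: "0 \<le> A2" "\<And>x. \<bar>\<eta> x\<bar> \<le> A2"
    using continuous_compact_support_bounded[OF \<eta>(1) D0 \<eta>(2)] by blast
  \<comment> \<open>\<open>D\<close> contains \<open>g - x\<close> whenever
    \<open>\<psi> (g - \<phi> x)\<close> or \<open>\<eta> (g - x)\<close> is nonzero, so restricting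
    the sums to \<open>g - x \<in> D\<close> drops only zero terms.\<close>
  have in_D: "g - x \<in> D" if "x \<in> X" "g - \<phi> x \<in> D0" for g x
  proof -
    have "(g - \<phi> x) + (\<phi> x - x) \<in> set_mult D0 K" using that K by (intro set_mult_I)
    then show ?thesis by (simp add: D algebra_simps)
  qed
  have \<psi>_cont: "continuous_on UNIV (\<lambda>g. \<psi> (g - z))" "continuous_on UNIV (\<lambda>g. \<psi> (y + g - z))" for z y
    by (intro continuous_intros continuous_on_compose2[OF \<psi>(1)]; simp)+
  have \<eta>_cont: "continuous_on UNIV (\<lambda>g. \<eta> (g - z))" "continuous_on UNIV (\<lambda>g. \<eta> (y + g - z))" for z y
    by (intro continuous_intros continuous_on_compose2[OF \<eta>(1)]; simp)+
  define F where "F y g = (\<Sum>x\<in>{x \<in> X. g - x \<in> D}. \<psi> (g - \<phi> x) * \<eta> (y + (g - x)))" for y g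
  define F' where "F' y g = (\<Sum>x\<in>{x \<in> X. g - x \<in> D}. \<eta> (g - x) * \<psi> (- y + (g - \<phi> x)))" for y g
  have prod_bd: "\<bar>\<psi> z * \<eta> w\<bar> \<le> A1 * A2" for z w
    unfolding abs_mult using A1 A2 by (intro mult_mono) auto
  have domF: "F y \<in> dominated b" for y
    unfolding F_def[abs_def]
    by (rule locally_finite_sum_dominated[OF X cD card_le, where c = "A1 * A2"])
      (use \<psi>_cont \<eta>_cont prod_bd A1 A2 in \<open>auto intro!: continuous_intros simp: add_diff_eq\<close>)
  have domF': "F' y \<in> dominated b" for y
    unfolding F'_def[abs_def]
    by (rule locally_finite_sum_dominated[OF X cD card_le, where c = "A1 * A2"])
      (use \<psi>_cont \<eta>_cont prod_bd A1 A2 in \<open>auto intro!: continuous_intros simp: add_diff_eq mult.commute[of "\<eta> _"]\<close>)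
  \<comment> \<open>The two index sets differ, but both sums reduce to the intersection: where
    \<open>- y + g - x\<close> is outside \<open>D\<close> the factor \<open>\<psi>\<close>
    vanishes, and where \<open>g - x\<close> is outside \<open>D\<close> the factor
    \<open>\<eta>\<close> vanishes.\<close>
  have F_eq: "F' y g = F y (- y + g)" for y g
  proof -
    have "F' y g = (\<Sum>x\<in>{x \<in> X. g - x \<in> D} \<inter> {x \<in> X. - y + g - x \<in> D}. \<eta> (g - x) * \<psi> (- y + (g - \<phi> x)))"
      unfolding F'_def by (rule sum.mono_neutral_right) (use X(2) \<psi>(2) in_D in \<open>auto simp: add_diff_eq\<close>)
    also have "\<dots> = (\<Sum>x\<in>{x \<in> X. g - x \<in> D} \<inter> {x \<in> X. - y + g - x \<in> D}.
        \<psi> (- y + g - \<phi> x) * \<eta> (y + (- y + g - x)))"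
      by (intro sum.cong refl) (simp add: add_diff_eq[symmetric])
    also have "\<dots> = F y (- y + g)"
      unfolding F_def
    proof (rule sum.mono_neutral_left)
      show "\<forall>x\<in>{x \<in> X. - y + g - x \<in> D} - {x \<in> X. g - x \<in> D} \<inter> {x \<in> X. - y + g - x \<in> D}.
          \<psi> (- y + g - \<phi> x) * \<eta> (y + (- y + g - x)) = 0"
        using \<eta>(2) by (auto simp: add_diff_eq[symmetric] D)
    qed (use X(2) in auto)
    finally show ?thesis .
  qed
  have MF: "M (F' y) = M (F y)" for y
    using M.left_invariant[of "F y" "- y"] domF[of y] domF'[of y] by (simp add: F_eq[abs_def])
  have "(\<integral>y. \<eta> y \<partial>m) * M (\<lambda>g. \<Sum>x\<in>{x \<in> X. g - x \<in> D}. \<psi> (g - \<phi> x)) = (\<integral>y. M (F y) \<partial>m)"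
    unfolding F_def[abs_def]
  proof (rule functional_integral_swap_sum[OF X cD card_le haar_group_axioms M lc \<eta>(1) D0 \<eta>(2)])
    show "compact (set_mult D0 (uminus ` D))" by (intro compact_set_mult compact_uminus D0 cD)
    fix x y g assume x: "x \<in> X" "g - x \<in> D" "y \<notin> set_mult D0 (uminus ` D)"
    have "y + (g - x) \<notin> D0"
    proof
      assume "y + (g - x) \<in> D0"
      then have "(y + (g - x)) + - (g - x) \<in> set_mult D0 (uminus ` D)"
        using x by (intro set_mult_I imageI)
      moreover have "(y + (g - x)) + - (g - x) = y" by (simp only: add.assoc right_minus add_0_right)
      ultimately show False using x(3) by simp
    qed
    then show "\<psi> (g - \<phi> x) * \<eta> (y + (g - x)) = 0" using \<eta>(2) by simp
  next
    \<comment> \<open>Here \<open>y\<close> is translated on the right, so unimodularity enters; the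
      companion integral below is treated by a left translation.\<close>
    show "(\<integral>y. \<eta> (y + (g - x)) \<partial>m) = (\<integral>y. \<eta> y \<partial>m)" for x g
      by (intro integral_right_translate borel_measurable_continuous_onI \<eta>)
  qed (use A1 \<psi>_cont in \<open>auto intro!: continuous_intros\<close>)
  moreover have "(\<integral>y. \<psi> (- y) \<partial>m) * M (\<lambda>g. \<Sum>x\<in>{x \<in> X. g - x \<in> D}. \<eta> (g - x)) = (\<integral>y. M (F' y) \<partial>m)"
    unfolding F'_def[abs_def]
  proof (rule functional_integral_swap_sum[OF X cD card_le haar_group_axioms M lc \<psi>(1) D0 \<psi>(2)])
    show "compact (set_mult (set_mult D (uminus ` K)) (uminus ` D0))"
      by (intro compact_set_mult compact_uminus D0 cD K)
    fix x y g assume x: "x \<in> X" "g - x \<in> D" "y \<notin> set_mult (set_mult D (uminus ` K)) (uminus ` D0)"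
    have "- y + (g - \<phi> x) \<notin> D0"
    proof
      assume "- y + (g - \<phi> x) \<in> D0"
      then have "((g - x) + - (\<phi> x - x)) + - (- y + (g - \<phi> x)) \<in> set_mult (set_mult D (uminus ` K)) (uminus ` D0)"
        using x K by (intro set_mult_I imageI)
      moreover have "((g - x) + - (\<phi> x - x)) + - (- y + (g - \<phi> x)) = y"
        by (simp add: algebra_simps)
      ultimately show False using x(3) by simp
    qed
    then show "\<eta> (g - x) * \<psi> (- y + (g - \<phi> x)) = 0" using \<psi>(2) by simp
  next
    fix x g
    have meas: "(\<lambda>y. \<psi> (- y + z)) \<in> borel_measurable borel" for z
      by (intro borel_measurable_continuous_onI continuous_intros continuous_on_compose2[OF \<psi>(1)]) auto
    \<comment> \<open>Replacing \<open>y\<close> by \<open>(g - \<phi> x) + y\<close> cancels the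
      shift and leaves \<open>\<psi> (- y)\<close>. This is the source of the inversion in the
      identity.\<close>
    have "(\<integral>y. \<psi> (- y + (g - \<phi> x)) \<partial>m) = (\<integral>y. \<psi> (- (g - \<phi> x + y) + (g - \<phi> x)) \<partial>m)"
      using integral_left_translate[OF meas[of "g - \<phi> x"], of "g - \<phi> x"] by simp
    also have "\<dots> = (\<integral>y. \<psi> (- y) \<partial>m)"
    proof -
      have "- (z + y) + z = - y" for y z :: 'a by (simp add: minus_add add.assoc)
      then show ?thesis by simp
    qed
    finally show "(\<integral>y. \<psi> (- y + (g - \<phi> x)) \<partial>m) = (\<integral>y. \<psi> (- y) \<partial>m)" .
  qed (use A2 \<eta>_cont in \<open>auto intro!: continuous_intros\<close>)
  ultimately show ?thesis using MF by simp
qed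

end


section \<open>Consequences of unimodularity and amenability\<close>

lemma (in haar_group) outer_regular_compact:
  assumes "compact K" "0 < e"
  obtains U where "open U" "K \<subseteq> U" "\<And>C. compact C \<Longrightarrow> C \<subseteq> U \<Longrightarrow> measure m C \<le> measure m K + e"
proof -
  have fin: "emeasure m K = ennreal (measure m K)"
    using emeasure_compact_finite[OF assms(1)] by (simp add: emeasure_eq_ennreal_measure less_top)
  have "(INF U \<in> {U. open U \<and> K \<subseteq> U}. emeasure m U) = emeasure m K"
    using haar compact_in_sets[OF assms(1)] sets_haar unfolding haar_measure_def by metis
  also have "\<dots> < ennreal (measure m K + e)"
    unfolding fin using assms(2) by (simp add: ennreal_lessI)
  finally obtain U where U: "open U" "K \<subseteq> U" "emeasure m U < ennreal (measure m K + e)"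
    by (auto simp: INF_less_iff)
  show ?thesis
  proof (rule that[OF U(1,2)])
    fix C assume C: "compact C" "C \<subseteq> U"
    have "emeasure m C \<le> emeasure m U"
      by (rule emeasure_mono[OF C(2) open_in_sets[OF U(1)]])
    also have "\<dots> < ennreal (measure m K + e)" by fact
    finally have "ennreal (measure m C) < ennreal (measure m K + e)"
      using emeasure_compact_finite[OF C(1)] by (simp add: emeasure_eq_ennreal_measure less_top)
    then have "measure m C < measure m K + e" by (simp add: ennreal_less_iff)
    then show "measure m C \<le> measure m K + e" by simp
  qed
qed

context unimodular_haar_group
begin

lemma measure_set_mult_singleton:
  assumes "compact A"
  shows "measure m (set_mult A {g}) = measure m A"
proof -
  have "set_mult A {g} = (\<lambda>x. x + g) ` A" by (auto simp: set_mult_def)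
  then show ?thesis
    using unimod[unfolded unimodular_def, rule_format, of A g] compact_in_sets[OF assms]
    by (simp add: measure_def sets_haar)
qed

lemma measure_pos_set_mult:
  assumes "compact K" "K \<noteq> {}" "compact A" "0 < measure m A"
  shows "0 < measure m (set_mult K A)"
proof -
  obtain k where k: "k \<in> K" using assms(2) by blast
  have "measure m A = measure m ((\<lambda>x. k + x) ` A)"
    using emeasure_translate[of A k] compact_in_sets[OF assms(3)] by (simp add: measure_def sets_haar)
  also have "\<dots> \<le> measure m (set_mult K A)"
    using k by (intro measure_mono_compact compact_translate compact_set_mult assms) (auto simp: set_mult_def)
  finally show ?thesis using assms by simp
qed

lemma measure_le_integral:
  fixes f :: "'a \<Rightarrow> real"
  assumes "compact K" "\<And>x. x \<in> K \<Longrightarrow> 1 \<le> f x" "\<And>x. 0 \<le> f x" "integrable m f"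
  shows "measure m K \<le> (\<integral>x. f x \<partial>m)"
proof -
  have "measure m K = (\<integral>x. indicator K x \<partial>m)" using compact_in_sets[OF assms(1)] by simp
  also have "\<dots> \<le> (\<integral>x. f x \<partial>m)"
    using assms emeasure_compact_finite[OF assms(1)] compact_in_sets[OF assms(1)]
    by (intro integral_mono integrable_real_indicator) (auto simp: indicator_def)
  finally show ?thesis .
qed

lemma integral_le_measure:
  fixes f :: "'a \<Rightarrow> real"
  assumes "compact D" "\<And>x. x \<notin> D \<Longrightarrow> f x = 0" "\<And>x. f x \<le> 1" "integrable m f"
  shows "(\<integral>x. f x \<partial>m) \<le> measure m D"
proof -
  have "(\<integral>x. f x \<partial>m) \<le> (\<integral>x. indicator D x \<partial>m)"
    using assms emeasure_compact_finite[OF assms(1)] compact_in_sets[OF assms(1)]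
    by (intro integral_mono integrable_real_indicator) (auto simp: indicator_def)
  also have "\<dots> = measure m D" using compact_in_sets[OF assms(1)] by simp
  finally show ?thesis .
qed

lemma continuous_compact_support_integrable:
  fixes f :: "'a \<Rightarrow> real"
  assumes "continuous_on UNIV f" "compact D" "\<And>x. x \<notin> D \<Longrightarrow> f x = 0"
  shows "integrable m f" "integrable m (\<lambda>x. f (- x))"
proof -
  obtain c where c: "0 \<le> c" "\<And>x. \<bar>f x\<bar> \<le> c"
    using continuous_compact_support_bounded[OF assms] by blast
  show "integrable m f"
    using assms c by (intro integrable_compact_support[where C = D and c = c] borel_measurable_continuous_onI)
  have "f (- x) = 0" if "x \<notin> uminus ` D" for x
    using that assms(3)[of "- x"] by (metis image_eqI minus_minus)
  moreover have "continuous_on UNIV (\<lambda>x. f (- x))"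
    by (intro continuous_on_compose2[OF assms(1)] continuous_on_minus continuous_on_id) auto
  ultimately show "integrable m (\<lambda>x. f (- x))"
    using c compact_uminus[OF assms(2)]
    by (intro integrable_compact_support[where C = "uminus ` D" and c = c] borel_measurable_continuous_onI)
qed

lemma exists_bump:
  assumes "compact K"
  obtains f :: "'a \<Rightarrow> real" and D where "continuous_on UNIV f" "compact D"
    "\<And>x. x \<notin> D \<Longrightarrow> f x = 0" "\<And>x. x \<in> K \<Longrightarrow> f x = 1" "\<And>x. 0 \<le> f x" "\<And>x. f x \<le> 1"
    "0 < (\<integral>x. f x \<partial>m)"
proof -
  obtain U V :: "'a set" where UV: "open U" "compact V" "0 \<in> U" "U \<subseteq> V"
    using compact_nhds_zero[OF lc open_UNIV UNIV_I] by metis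
  \<comment> \<open>A neighbourhood of 0 is adjoined to \<open>K\<close> so that the integral is
    positive even when \<open>K\<close> is empty or null.\<close>
  have KV: "compact (K \<union> V)" using assms UV by auto
  obtain f :: "'a \<Rightarrow> real" and D where f: "continuous_on UNIV f" "compact D" "D \<subseteq> UNIV"
    "\<And>x. x \<notin> D \<Longrightarrow> f x = 0" "\<And>x. x \<in> K \<union> V \<Longrightarrow> f x = 1" "\<And>x. 0 \<le> f x" "\<And>x. f x \<le> 1"
    using Urysohn_compact_support[OF lc KV open_UNIV subset_UNIV] by metis
  have "0 < measure m V" using UV by (intro measure_pos[of U]) auto
  also have "\<dots> \<le> (\<integral>x. f x \<partial>m)"
    using UV f continuous_compact_support_integrable[OF f(1,2,4)] by (intro measure_le_integral) auto
  finally show ?thesis using that[OF f(1,2,4)] f by auto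
qed

lemma integral_dominated_functional:
  assumes D: "compact D"
  shows "dominated_functional (\<lambda>f. \<integral>x. f x \<partial>m) (indicator D) (measure m D)"
proof -
  have int: "integrable m f" if f: "f \<in> dominated (indicator D)" for f
  proof -
    obtain c where c: "f \<in> borel_measurable borel" "\<forall>x. \<bar>f x\<bar> \<le> c * indicator D x"
      using f unfolding dominated_def by blast
    have "\<bar>f x\<bar> \<le> \<bar>c\<bar>" for x using c(2)[rule_format, of x] by (cases "x \<in> D") auto
    moreover have "f x = 0" if "x \<notin> D" for x using c(2)[rule_format, of x] that by auto
    ultimately show ?thesis using c(1) D by (intro integrable_compact_support)
  qed
  show ?thesis
  proof
    fix f e assume f: "f \<in> dominated (indicator D)" "0 \<le> (e::real)" "\<And>x. \<bar>f x\<bar> \<le> e * indicator D x"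
    have "\<bar>\<integral>x. f x \<partial>m\<bar> \<le> (\<integral>x. \<bar>f x\<bar> \<partial>m)" by (rule integral_abs_bound)
    also have "\<dots> \<le> (\<integral>x. e * indicator D x \<partial>m)"
      using int[OF f(1)] f(3) emeasure_compact_finite[OF D] compact_in_sets[OF D]
      by (intro integral_mono integrable_real_indicator integrable_mult_right) auto
    also have "\<dots> = e * measure m D" using compact_in_sets[OF D] by simp
    finally show "\<bar>\<integral>x. f x \<partial>m\<bar> \<le> e * measure m D" .
  next
    fix f y assume "f \<in> dominated (indicator D :: 'a \<Rightarrow> real)"
    then show "(\<integral>x. f (y + x) \<partial>m) = (\<integral>x. f x \<partial>m)"
      by (intro integral_left_translate) (simp add: dominated_def)
  qed (use int in auto)
qed

text \<open>For \<open>X = {0}\<close> and no displacement the sums collapse to \<open>f g\<close>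
  and \<open>h g\<close>. The identity then has the integral of \<open>h\<close> as a factor on both
  sides, and \<open>h\<close> is chosen so that this factor is positive and cancels.\<close>

lemma integral_uminus:
  fixes f :: "'a \<Rightarrow> real"
  assumes f: "continuous_on UNIV f" "compact D" "\<And>x. x \<notin> D \<Longrightarrow> f x = 0"
  shows "(\<integral>x. f (- x) \<partial>m) = (\<integral>x. f x \<partial>m)"
proof -
  obtain h :: "'a \<Rightarrow> real" and E where h: "continuous_on UNIV h" "compact E" "\<And>x. x \<notin> E \<Longrightarrow> h x = 0"
    "0 < (\<integral>x. h x \<partial>m)"
    using exists_bump[OF compact_empty] by metis
  define D0 where "D0 = D \<union> E"
  have D0: "compact D0" using f h by (simp add: D0_def compact_Un)
  have D: "D0 = D0 \<union> set_mult D0 {0}" by (auto simp: set_mult_def)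
  have zero: "\<And>x. x \<notin> D0 \<Longrightarrow> f x = 0" "\<And>x. x \<notin> D0 \<Longrightarrow> h x = 0"
    using f h by (auto simp: D0_def)
  have X: "{x \<in> {0::'a}. g - x \<in> D0} = (if g \<in> D0 then {0} else {})" for g by auto
  have cardX: "real (card {x \<in> {0}. g - x \<in> D0}) \<le> indicator D0 g" for g
    unfolding X by simp
  have id: "(\<integral>y. h y \<partial>m) * (\<integral>g. (\<Sum>x\<in>{x \<in> {0}. g - x \<in> D0}. f (g - x)) \<partial>m)
      = (\<integral>y. f (- y) \<partial>m) * (\<integral>g. (\<Sum>x\<in>{x \<in> {0}. g - x \<in> D0}. h (g - x)) \<partial>m)"
    by (rule functional_translation_identity[OF integral_dominated_functional[OF D0] _ _ D cardX _ _ D0 f(1) zero(1) h(1) zero(2)])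
      simp_all
  have sum_eq: "(\<Sum>x\<in>{x \<in> {0}. g - x \<in> D0}. k (g - x)) = k g" if "\<forall>x. x \<notin> D0 \<longrightarrow> k x = 0" for k :: "'a \<Rightarrow> real" and g
    using that[rule_format, of g] unfolding X by simp
  have "(\<Sum>x\<in>{x \<in> {0}. g - x \<in> D0}. f (g - x)) = f g"
    "(\<Sum>x\<in>{x \<in> {0}. g - x \<in> D0}. h (g - x)) = h g" for g
    using sum_eq[of f g] sum_eq[of h g] zero by blast+
  then have "(\<integral>y. h y \<partial>m) * (\<integral>g. f g \<partial>m) = (\<integral>y. f (- y) \<partial>m) * (\<integral>g. h g \<partial>m)"
    using id by (simp only:)
  then show ?thesis using h(4) by (simp add: mult.commute)
qed

text \<open>A continuous function squeezed between \<open>K\<close> and an open set of nearly the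
  same measure transfers inversion invariance from integrals to one inequality of measures. Applying
  that inequality to \<open>-K\<close> as well gives equality.\<close>

lemma measure_uminus_compact:
  assumes "compact K"
  shows "measure m (uminus ` K) = measure m K"
proof -
  have le: "measure m (uminus ` K) \<le> measure m K" if K: "compact K" for K
  proof (rule field_le_epsilon)
    fix e :: real assume e: "0 < e"
    obtain U where U: "open U" "K \<subseteq> U" "\<And>C. compact C \<Longrightarrow> C \<subseteq> U \<Longrightarrow> measure m C \<le> measure m K + e"
      using outer_regular_compact[OF K e] by metis
    obtain f :: "'a \<Rightarrow> real" and D where f: "continuous_on UNIV f" "compact D" "D \<subseteq> U"
      "\<And>x. x \<notin> D \<Longrightarrow> f x = 0" "\<And>x. x \<in> K \<Longrightarrow> f x = 1" "\<And>x. 0 \<le> f x" "\<And>x. f x \<le> 1"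
      using Urysohn_compact_support[OF lc K U(1,2)] by metis
    have "measure m (uminus ` K) \<le> (\<integral>x. f (- x) \<partial>m)"
      using f(5,6) compact_uminus[OF K] continuous_compact_support_integrable[OF f(1,2,4)]
      by (intro measure_le_integral) auto
    also have "\<dots> = (\<integral>x. f x \<partial>m)" by (rule integral_uminus[OF f(1,2,4)])
    also have "\<dots> \<le> measure m D"
      using f continuous_compact_support_integrable[OF f(1,2,4)] by (intro integral_le_measure) auto
    also have "\<dots> \<le> measure m K + e" by (rule U(3)[OF f(2,3)])
    finally show "measure m (uminus ` K) \<le> measure m K + e" .
  qed
  have "measure m (uminus ` uminus ` K) \<le> measure m (uminus ` K)"
    by (rule le[OF compact_uminus[OF assms]])
  then show ?thesis using le[OF assms] by (simp add: image_image)
qed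

text \<open>A mean is monotone and fixes constants, so a function bounded by \<open>e * c\<close>
  has mean at most \<open>e * c\<close> in absolute value. This is the \<open>bound\<close> axiom
  with \<open>b\<close> constantly \<open>c\<close> and \<open>B = c\<close>.\<close>

lemma amenable_functional:
  assumes "amenable m" "0 \<le> c"
  obtains M :: "('a \<Rightarrow> real) \<Rightarrow> real" where "dominated_functional M (\<lambda>_. c) c" "M (\<lambda>_. 1) = 1"
    "\<And>f g. (\<exists>s. f \<in> dominated (\<lambda>_. s)) \<Longrightarrow> (\<exists>s. g \<in> dominated (\<lambda>_. s)) \<Longrightarrow> (\<And>x. f x \<le> g x) \<Longrightarrow> M f \<le> M g"
proof -
  from assms(1)[unfolded amenable_def] obtain M where M':
    "(\<forall>f\<in>Linfty m. \<forall>g\<in>Linfty m. \<forall>a b. M (\<lambda>x. a * f x + b * g x) = a * M f + b * M g) \<and>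
     (\<forall>f\<in>Linfty m. (AE x in m. 0 \<le> f x) \<longrightarrow> 0 \<le> M f) \<and>
     M (\<lambda>_. 1) = 1 \<and>
     (\<forall>f\<in>Linfty m. \<forall>g\<in>Linfty m. (AE x in m. f x = g x) \<longrightarrow> M f = M g) \<and>
     (\<forall>f\<in>Linfty m. \<forall>y. M (\<lambda>x. f (y + x)) = M f)"
    by (rule exE)
  note M = M'[THEN conjunct1, rule_format] M'[THEN conjunct2, THEN conjunct1, rule_format]
    M'[THEN conjunct2, THEN conjunct2, THEN conjunct1]
    M'[THEN conjunct2, THEN conjunct2, THEN conjunct2, THEN conjunct2, rule_format]
  have Linf: "f \<in> Linfty m" if f: "f \<in> dominated (\<lambda>_. s)" for f s
  proof -
    obtain c where "f \<in> borel_measurable borel" "\<forall>x. \<bar>f x\<bar> \<le> c * s"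
      using f unfolding dominated_def by blast
    then show ?thesis unfolding Linfty_def by (simp add: measurable_haar_iff exI[of _ "c * s"])
  qed
  have const: "(\<lambda>_. 1) \<in> Linfty m" by (rule Linf[of _ 1]) (auto intro!: dominatedI[of _ 1])
  have mono: "M f \<le> M g" if fg: "f \<in> Linfty m" "g \<in> Linfty m" "\<And>x. f x \<le> g x" for f g
  proof -
    have "(\<lambda>x. (- 1) * f x + 1 * g x) \<in> Linfty m"
    proof -
      obtain s t where "AE x in m. \<bar>f x\<bar> \<le> s" "AE x in m. \<bar>g x\<bar> \<le> t"
        using fg unfolding Linfty_def by blast
      then have "AE x in m. \<bar>(- 1) * f x + 1 * g x\<bar> \<le> s + t" by eventually_elim auto
      then show ?thesis using that(1,2) by (auto simp: Linfty_def)
    qed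
    then have "0 \<le> M (\<lambda>x. (- 1) * f x + 1 * g x)" by (rule M(2)) (use that(3) in auto)
    then show ?thesis using M(1)[OF that(1,2), of "- 1" 1] by simp
  qed
  have scaled: "(\<lambda>_. s) \<in> Linfty m \<and> M (\<lambda>_. s) = s" for s
  proof -
    have "(\<lambda>_::'a. s) \<in> Linfty m" by (rule Linf[of _ "\<bar>s\<bar>"]) (auto intro!: dominatedI[of _ 1])
    then show ?thesis using M(1)[OF const const, of s 0] M(3) by simp
  qed
  have "dominated_functional M (\<lambda>_. c) c"
  proof
    fix f :: "'a \<Rightarrow> real" and e assume f: "f \<in> dominated (\<lambda>_. c)" "0 \<le> (e::real)" "\<And>x. \<bar>f x\<bar> \<le> e * c"
    have "f x \<le> e * c" "- (e * c) \<le> f x" for x using f(3)[of x] by auto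
    then show "\<bar>M f\<bar> \<le> e * c"
      using mono[OF Linf[OF f(1)] conjunct1[OF scaled[of "e * c"]]]
        mono[OF conjunct1[OF scaled[of "- (e * c)"]] Linf[OF f(1)]] scaled[of "e * c"] scaled[of "- (e * c)"]
      by simp
  qed (use assms(2) M(1,4) Linf in auto)
  then show ?thesis using that[of M] M(3) mono Linf by blast
qed

text \<open>Both displaced copies of \<open>X\<close> have the same mean bump sum as
  \<open>X\<close> itself, while by disjointness their bump sums add up to at most that of
  \<open>X\<close>. So this mean would be at most 0, whereas \<open>dense\<close> forces it to be at
  least 1.\<close>

lemma amenable_no_doubling:
  fixes X K :: "'a set"
  assumes amen: "amenable m" and X: "countable X" "\<And>A. compact A \<Longrightarrow> finite (X \<inter> A)"
    and bounded: "\<And>D. compact D \<Longrightarrow> \<exists>n. \<forall>g. real (card {x \<in> X. g - x \<in> D}) \<le> n"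
    and dense: "compact E" "\<And>g. \<exists>x\<in>X. g - x \<in> E"
    and K: "compact K" "\<And>F. finite F \<Longrightarrow> F \<subseteq> X \<Longrightarrow> 2 * card F \<le> card (X \<inter> set_mult K F)"
  shows False
proof -
  have finN: "finite (X \<inter> set_mult K {x})" for x
    by (intro X(2) compact_set_mult K(1)) simp
  have dbl: "2 * card J \<le> card (\<Union>x\<in>J. X \<inter> set_mult K {x})" if "finite J" "J \<subseteq> X" for J
  proof -
    have "(\<Union>x\<in>J. X \<inter> set_mult K {x}) = X \<inter> set_mult K J" by (auto simp: set_mult_def)
    then show ?thesis using K(2)[OF that] by simp
  qed
  obtain f g where fg: "inj_on f X" "inj_on g X" "f ` X \<inter> g ` X = {}"
    "\<And>x. x \<in> X \<Longrightarrow> f x \<in> X \<inter> set_mult K {x}" "\<And>x. x \<in> X \<Longrightarrow> g x \<in> X \<inter> set_mult K {x}"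
    by (rule hall_marriage_two[of X "\<lambda>x. X \<inter> set_mult K {x}", OF finN dbl]) blast+
  obtain \<psi> :: "'a \<Rightarrow> real" and D0 where \<psi>: "continuous_on UNIV \<psi>" "compact D0"
    "\<And>x. x \<notin> D0 \<Longrightarrow> \<psi> x = 0" "\<And>x. x \<in> E \<Longrightarrow> \<psi> x = 1" "\<And>x. 0 \<le> \<psi> x" "\<And>x. \<psi> x \<le> 1"
    "0 < (\<integral>x. \<psi> x \<partial>m)"
    using exists_bump[OF dense(1)] by metis
  define D where "D = D0 \<union> set_mult D0 (insert 0 K)"
  have cD: "compact D" unfolding D_def by (simp add: compact_Un compact_set_mult \<psi>(2) K(1) compact_insert)
  obtain n where n: "\<And>u. real (card {x \<in> X. u - x \<in> D}) \<le> n" using bounded[OF cD] by blast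
  then have n0: "0 \<le> n" using of_nat_0_le_iff order_trans by blast
  have finX: "finite {x \<in> X. u - x \<in> D}" for u
    unfolding diff_mem_eq_Int_set_mult by (intro X(2) compact_set_mult compact_uminus cD) simp
  obtain M :: "('a \<Rightarrow> real) \<Rightarrow> real" where M: "dominated_functional M (\<lambda>_. n) n" "M (\<lambda>_. 1) = 1"
    "\<And>f g. (\<exists>s. f \<in> dominated (\<lambda>_. s)) \<Longrightarrow> (\<exists>s. g \<in> dominated (\<lambda>_. s)) \<Longrightarrow> (\<And>x. f x \<le> g x) \<Longrightarrow> M f \<le> M g"
    using amenable_functional[OF amen n0] by metis
  interpret M: dominated_functional M "\<lambda>_. n" n by fact
  define S where "S \<phi> u = (\<Sum>x\<in>{x \<in> X. u - x \<in> D}. \<psi> (u - \<phi> x))" for \<phi> u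
  have dom: "S \<phi> \<in> dominated (\<lambda>_. n)" for \<phi>
    unfolding S_def[abs_def]
    by (rule locally_finite_sum_dominated[OF X(1) finX cD n, where c = 1])
      (use \<psi>(5,6) in \<open>auto intro!: continuous_intros continuous_on_compose2[OF \<psi>(1)]\<close>)
  have MS: "M (S \<phi>) = M (S (\<lambda>x. x))" if "\<And>x. x \<in> X \<Longrightarrow> \<phi> x \<in> set_mult K {x}" for \<phi>
  proof -
    have "\<phi> x - x \<in> insert 0 K" if "x \<in> X" for x
      using \<open>\<And>x. x \<in> X \<Longrightarrow> \<phi> x \<in> set_mult K {x}\<close>[OF that] by (auto simp: set_mult_def)
    then have "(\<integral>y. \<psi> y \<partial>m) * M (S \<phi>) = (\<integral>y. \<psi> (- y) \<partial>m) * M (S (\<lambda>x. x))"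
      unfolding S_def[abs_def]
      by (intro functional_translation_identity[OF M(1) X(1) finX D_def n _ _ \<psi>(2,1,3,1,3)])
        (simp_all add: compact_insert K(1))
    \<comment> \<open>The factors on the two sides agree by inversion invariance and are positive,
      so they cancel.\<close>
    then show ?thesis using integral_uminus[OF \<psi>(1,2,3)] \<psi>(7) by simp
  qed
  have le: "1 * S f u + 1 * S g u \<le> S (\<lambda>x. x) u" for u
  proof -
    let ?Y = "{x \<in> X. u - x \<in> D}"
    have "S f u = (\<Sum>z\<in>f ` ?Y. \<psi> (u - z))"
      unfolding S_def using inj_on_subset[OF fg(1), of ?Y] by (subst sum.reindex) auto
    moreover have "S g u = (\<Sum>z\<in>g ` ?Y. \<psi> (u - z))"
      unfolding S_def using inj_on_subset[OF fg(2), of ?Y] by (subst sum.reindex) auto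
    moreover have "f ` ?Y \<inter> g ` ?Y = {}" using fg(3) by blast
    ultimately have "S f u + S g u = (\<Sum>z\<in>f ` ?Y \<union> g ` ?Y. \<psi> (u - z))"
      using finX by (subst sum.union_disjoint) auto
    \<comment> \<open>Displaced points that have left the window \<open>?Y\<close> contribute
      nothing, since \<open>D\<close> contains the support of \<open>\<psi>\<close>.\<close>
    also have "\<dots> = (\<Sum>z\<in>(f ` ?Y \<union> g ` ?Y) \<inter> ?Y. \<psi> (u - z))"
      using finX fg(4,5) \<psi>(3) by (intro sum.mono_neutral_right) (auto simp: D_def)
    also have "\<dots> \<le> (\<Sum>z\<in>?Y. \<psi> (u - z))"
      using finX \<psi>(5) by (intro sum_mono2) auto
    finally show ?thesis by (simp add: S_def)
  qed
  have ge: "1 \<le> S (\<lambda>x. x) u" for u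
  proof -
    obtain x where x: "x \<in> X" "u - x \<in> E" using dense(2) by blast
    then have "u - x \<in> D" using \<psi>(3,4)[of "u - x"] by (auto simp: D_def)
    then have "\<psi> (u - x) \<le> S (\<lambda>x. x) u"
      unfolding S_def using finX x \<psi>(5) by (intro member_le_sum) auto
    then show ?thesis using \<psi>(4)[OF x(2)] by simp
  qed
  have "M (S f) = M (S (\<lambda>x. x))" "M (S g) = M (S (\<lambda>x. x))" using MS fg(4,5) by auto
  moreover have "M (\<lambda>u. 1 * S f u + 1 * S g u) \<le> M (S (\<lambda>x. x))"
    using M(3) dom le dominated_lin[OF dom dom] by blast
  moreover have "M (\<lambda>u. 1 * S f u + 1 * S g u) = 1 * M (S f) + 1 * M (S g)"
    by (rule M.lin[OF dom dom])
  moreover have "M (\<lambda>_. 1) \<le> M (S (\<lambda>x. x))"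
  proof (rule M(3))
    show "\<exists>s. (\<lambda>_. 1) \<in> dominated (\<lambda>_. s)" by (rule exI[of _ 1]) (rule dominatedI[of _ 1], auto)
  qed (use dom ge in auto)
  ultimately show False using M(2) by simp
qed

end


section \<open>The lower Leptin density is at most the upper one\<close>

lemma delta_mono: "S \<subseteq> T \<Longrightarrow> A \<subseteq> B \<Longrightarrow> delta S A \<le> delta T B"
  unfolding delta_def
  by (auto intro!: card_mono intro: finite_subset[of "S \<inter> A" "T \<inter> B"])

lemma compact_set_mult_iterate:
  fixes R :: "'a::topological_group_add set"
  assumes "compact R"
  shows "compact ((set_mult R ^^ n) {0})"
  by (induction n) (auto intro: compact_set_mult assms)

context unimodular_haar_group
begin

lemma leptin_lower_le_upper:
  assumes amen: "amenable m" and X: "countable X"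
  shows "leptin_lower m (delta X) \<le> leptin_upper m (delta X)"
proof (rule ccontr)
  assume "\<not> ?thesis"
  then obtain c' where c': "leptin_upper m (delta X) < ereal c'" "ereal c' < leptin_lower m (delta X)"
    using ereal_dense2 by (meson not_le)
  then obtain c where c: "ereal c' < ereal c" "ereal c < leptin_lower m (delta X)"
    using ereal_dense2 by blast
  from c'(1)[unfolded leptin_upper_def INF_less_iff] obtain K'
    where K'0: "K' \<in> {K. compact K \<and> K \<noteq> {}}"
    and sup: "(SUP A \<in> {A. compact A \<and> A \<noteq> {} \<and> 0 < measure m A}. delta X A / ereal (measure m (set_mult K' A))) < ereal c'"
    by (rule bexE)
  have up: "delta X A / ereal (measure m (set_mult K' A)) < ereal c'"
    if "compact A" "A \<noteq> {}" "0 < measure m A" for A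
    by (rule le_less_trans[OF SUP_upper sup]) (use that in simp)
  have K': "compact K'" "K' \<noteq> {}" using K'0 by auto
  \<comment> \<open>Finiteness comes with the estimate: otherwise \<open>delta X A\<close> is
    infinite and the quotient could not lie below \<open>c'\<close>.\<close>
  have upper: "finite (X \<inter> A) \<and> real (card (X \<inter> A)) < c' * measure m (set_mult K' A)"
    if A: "compact A" "A \<noteq> {}" "0 < measure m A" for A
  proof -
    have pos: "0 < measure m (set_mult K' A)" by (rule measure_pos_set_mult[OF K' A(1,3)])
    show ?thesis
    proof (cases "finite (X \<inter> A)")
      case True
      then show ?thesis using up[OF A] pos by (simp add: delta_def field_simps)
    next
      case False
      then show ?thesis using up[OF A] pos by (simp add: delta_def)
    qed
  qed
  from c(2)[unfolded leptin_lower_def less_SUP_iff] obtain K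
    where K0: "K \<in> {K. compact K \<and> K \<noteq> {}}"
    and inf: "ereal c < (INF A \<in> {A. compact A \<and> A \<noteq> {} \<and> 0 < measure m A}. delta X (set_mult K A) / ereal (measure m A))"
    by (rule bexE)
  have lo: "ereal c < delta X (set_mult K A) / ereal (measure m A)"
    if "compact A" "A \<noteq> {}" "0 < measure m A" for A
    by (rule less_le_trans[OF inf INF_lower]) (use that in simp)
  have K: "compact K" "K \<noteq> {}" using K0 by auto
  have lower: "c * measure m A < real (card (X \<inter> set_mult K A))"
    if A: "compact A" "A \<noteq> {}" "0 < measure m A" for A
  proof -
    have "finite (X \<inter> set_mult K A)"
      using upper[of "set_mult K A"] measure_pos_set_mult[OF K A(1,3)] compact_set_mult[OF K(1) A(1)] K A
      by (auto simp: set_mult_eq_empty)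
    then show ?thesis using lo[OF A] A(3) by (simp add: delta_def field_simps)
  qed
  obtain U V :: "'a set" where UV: "open U" "compact V" "0 \<in> U" "U \<subseteq> V"
    using compact_nhds_zero[OF lc open_UNIV UNIV_I] by metis
  have V: "V \<noteq> {}" "0 < measure m V" using UV measure_pos[of U V] by auto
  have "0 < c'"
  proof -
    have "0 < c' * measure m (set_mult K' V)" using upper[OF UV(2) V] by (auto intro: le_less_trans[rotated])
    then show ?thesis using measure_nonneg[of m "set_mult K' V"] by (simp add: zero_less_mult_iff)
  qed
  then have pos: "0 < c'" "0 < c" "c' < c" using c by auto
  \<comment> \<open>A nonempty compact \<open>A\<close> may be null, for instance finite, and then
    it is not admissible in the densities. Thickening it by \<open>V\<close> gives positive measure,
    and absorbing \<open>V\<close> into \<open>Q\<close> yields an upper bound for every compact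
    \<open>A\<close>.\<close>
  define Q where "Q = set_mult K' V"
  have Q: "compact Q" "Q \<noteq> {}" using K' UV V by (auto simp: Q_def compact_set_mult set_mult_eq_empty)
  have VA_pos: "0 < measure m (set_mult V A)" if A: "compact A" "A \<noteq> {}" for A
  proof -
    obtain a where a: "a \<in> A" using A by blast
    have "0 < measure m (set_mult V {a})" using V measure_set_mult_singleton[OF UV(2)] by simp
    also have "\<dots> \<le> measure m (set_mult V A)"
      using a A UV by (intro measure_mono_compact compact_set_mult set_mult_mono) auto
    finally show ?thesis .
  qed
  have bound: "finite (X \<inter> A) \<and> real (card (X \<inter> A)) \<le> c' * measure m (set_mult Q A)" if A: "compact A" for A
  proof (cases "A = {}")
    case False
    have sub: "X \<inter> A \<subseteq> X \<inter> set_mult V A"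
      using UV(3,4) set_mult_I[of 0 V _ A] by fastforce
    have "finite (X \<inter> set_mult V A) \<and> real (card (X \<inter> set_mult V A)) < c' * measure m (set_mult K' (set_mult V A))"
      using False by (intro upper VA_pos A compact_set_mult UV) (auto simp: set_mult_eq_empty V)
    then show ?thesis
      using card_mono[OF _ sub] finite_subset[OF sub] by (auto simp: Q_def set_mult_assoc)
  qed (use pos in auto)
  \<comment> \<open>Upper and lower estimates meet at \<open>Q + A\<close>: the count in
    \<open>A\<close> is at most \<open>c'\<close> times its measure, and the count in
    \<open>K + Q + A\<close> exceeds \<open>c\<close> times its measure. Hence thickening by
    \<open>R\<close> multiplies counts by at least \<open>c / c'\<close>, which is greater than
    1.\<close>
  define R where "R = set_mult K Q"
  have R: "compact R" using K Q by (simp add: R_def compact_set_mult)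
  define q where "q = c / c'"
  have q: "1 < q" using pos by (simp add: q_def)
  have grow: "q * card (X \<inter> A) \<le> card (X \<inter> set_mult R A)" if A: "compact A" for A
  proof (cases "A = {}")
    case False
    have "0 < measure m (set_mult Q A)"
      unfolding Q_def set_mult_assoc
      by (intro measure_pos_set_mult K' VA_pos compact_set_mult UV A False)
    then have "c * measure m (set_mult Q A) < card (X \<inter> set_mult R A)"
      unfolding R_def set_mult_assoc
      using A False Q by (intro lower compact_set_mult) (auto simp: set_mult_eq_empty)
    moreover have "q * card (X \<inter> A) \<le> q * (c' * measure m (set_mult Q A))"
      using bound[OF A] q by (intro mult_left_mono) auto
    ultimately show ?thesis using pos by (simp add: q_def)
  qed simp
  define P where "P n = (set_mult R ^^ n) {0}" for n
  have P: "compact (P n)" for n unfolding P_def by (rule compact_set_mult_iterate[OF R])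
  have iter: "q ^ n * card (X \<inter> A) \<le> card (X \<inter> set_mult (P n) A)" if A: "compact A" for A n
  proof (induction n)
    case 0
    have "set_mult {0} A = A" by (auto simp: set_mult_def)
    then show ?case by (simp add: P_def)
  next
    case (Suc n)
    have "q ^ Suc n * card (X \<inter> A) \<le> q * card (X \<inter> set_mult (P n) A)"
      using Suc q by simp
    also have "\<dots> \<le> card (X \<inter> set_mult R (set_mult (P n) A))"
      by (intro grow compact_set_mult P A)
    finally show ?case by (simp add: P_def set_mult_assoc)
  qed
  obtain n where n: "2 < q ^ n" using real_arch_pow[OF q] by blast
  show False
  \<comment> \<open>The lower estimate puts a point \<open>w + g\<close> of \<open>X\<close> into
    \<open>K + V + g\<close> for every \<open>g\<close>. Since \<open>g - (w + g) = - w\<close>, the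
    set \<open>-(K + V)\<close> witnesses density.\<close>
  proof (rule amenable_no_doubling[OF amen X, where K = "P n" and E = "uminus ` set_mult K V"])
    show "finite (X \<inter> A)" if "compact A" for A using bound[OF that] by simp
    show "compact (P n)" by (rule P)
    show "compact (uminus ` set_mult K V)" by (intro compact_uminus compact_set_mult K UV)
    show "2 * card F \<le> card (X \<inter> set_mult (P n) F)" if F: "finite F" "F \<subseteq> X" for F
    proof -
      have "X \<inter> F = F" using F by blast
      then have "q ^ n * card F \<le> card (X \<inter> set_mult (P n) F)"
        using iter[OF finite_imp_compact[OF F(1)], of n] by simp
      moreover have "2 * real (card F) \<le> q ^ n * card F" using n by (intro mult_right_mono) auto
      ultimately show ?thesis by linarith
    qed
    show "\<exists>k. \<forall>g. real (card {x \<in> X. g - x \<in> D}) \<le> k" if D: "compact D" for D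
    proof (intro exI allI)
      fix g
      have cD: "compact (set_mult (uminus ` D) {g})" by (intro compact_set_mult compact_uminus D) simp
      have "real (card {x \<in> X. g - x \<in> D}) = real (card (X \<inter> set_mult (uminus ` D) {g}))"
        by (simp only: diff_mem_eq_Int_set_mult)
      also have "\<dots> \<le> c' * measure m (set_mult Q (set_mult (uminus ` D) {g}))" using bound[OF cD] by simp
      \<comment> \<open>Right invariance removes \<open>g\<close>, which makes the bound
        uniform.\<close>
      also have "\<dots> = c' * measure m (set_mult Q (uminus ` D))"
        unfolding set_mult_assoc[symmetric]
        by (subst measure_set_mult_singleton) (intro compact_set_mult compact_uminus Q D refl)+
      finally show "real (card {x \<in> X. g - x \<in> D}) \<le> c' * measure m (set_mult Q (uminus ` D))" .
    qed
    show "\<exists>x\<in>X. g - x \<in> uminus ` set_mult K V" for g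
    proof -
      have "0 < c * measure m (set_mult V {g})"
        using pos V by (simp add: measure_set_mult_singleton[OF UV(2)])
      also have "\<dots> < card (X \<inter> set_mult K (set_mult V {g}))"
        using V UV by (intro lower compact_set_mult) (auto simp: measure_set_mult_singleton set_mult_eq_empty)
      finally have "X \<inter> set_mult (set_mult K V) {g} \<noteq> {}" unfolding set_mult_assoc by auto
      then obtain w where w: "w \<in> set_mult K V" "w + g \<in> X" by (auto simp: set_mult_def)
      have "g - (w + g) = - w" by (simp add: diff_conv_add_uminus minus_add add.assoc[symmetric] del: add_uminus_conv_diff)
      then show ?thesis using w by (intro bexI[OF _ w(2)]) auto
    qed
  qed
qed

end


section \<open>Fundamental domains of uniform lattices\<close>

lemma uminus_set_mult:
  fixes A B :: "'a::group_add set"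
  shows "uminus ` set_mult A B = set_mult (uminus ` B) (uminus ` A)"
proof (intro equalityI subsetI)
  fix x assume "x \<in> uminus ` set_mult A B"
  then obtain a b where "a \<in> A" "b \<in> B" "x = - b + - a" by (auto simp: set_mult_def minus_add)
  then show "x \<in> set_mult (uminus ` B) (uminus ` A)" by (simp only: set_mult_I imageI)
next
  fix x assume "x \<in> set_mult (uminus ` B) (uminus ` A)"
  then obtain a b where ab: "a \<in> A" "b \<in> B" "x = - b + - a" by (auto simp: set_mult_def)
  then have "x = - (a + b)" by (simp only: minus_add)
  then show "x \<in> uminus ` set_mult A B" using ab by (simp only: set_mult_I imageI)
qed

lemma open_uminus:
  fixes U :: "'a::topological_group_add set"
  assumes "open U"
  shows "open (uminus ` U)"
proof -
  have "uminus ` U = uminus -` U" by (force simp: image_iff)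
  then show ?thesis using assms by (simp add: open_vimage continuous_on_minus continuous_on_id)
qed

lemma open_nhds_zero_diff:
  fixes U :: "'a::topological_group_add set"
  assumes "open U" "0 \<in> U"
  obtains U' where "open U'" "0 \<in> U'" "\<And>a b. a \<in> U' \<Longrightarrow> b \<in> U' \<Longrightarrow> a - b \<in> U"
proof -
  have "open ((\<lambda>p. fst p - snd p) -` U)" by (intro open_vimage assms continuous_intros)
  moreover have "(0, 0) \<in> (\<lambda>p. fst p - snd p) -` U" using assms by simp
  ultimately obtain A B where AB: "open A" "open B" "(0, 0) \<in> A \<times> B" "A \<times> B \<subseteq> (\<lambda>p. fst p - snd p) -` U"
    by (rule open_prod_elim)
  show ?thesis
    by (rule that[of "A \<inter> B"]) (use AB in auto)
qed

context haar_group
begin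

lemma translate_in_sets:
  assumes "A \<in> sets m"
  shows "(\<lambda>x. g + x) ` A \<in> sets m"
proof -
  have "(\<lambda>x. g + x) ` A = (\<lambda>x. - g + x) -` A \<inter> space m"
    by (auto simp: image_iff) (metis add_minus_cancel)
  then show ?thesis using measurable_sets[OF left_translate_measurable assms, of "- g"] by simp
qed

text \<open>\<open>K\<close> is cut into finitely many pieces so small that none contains two points
  of the same coset. Discarding from each piece the cosets already met by earlier ones leaves one
  representative per coset. Keeping \<open>F\<close> inside a prescribed \<open>K\<close> is what
  later confines it to a thin product set.\<close>

lemma fundamental_domain_subset:
  assumes L: "uniform_lattice L" and K: "compact K" "\<And>z. \<exists>k\<in>K. \<exists>l\<in>L. z = l + k"
  obtains F where "fundamental_domain m L F" "F \<subseteq> K"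
proof -
  have cL: "countable L" and L0: "0 \<in> L" and Ladd: "\<And>x y. x \<in> L \<Longrightarrow> y \<in> L \<Longrightarrow> x + y \<in> L"
    and Lminus: "\<And>x. x \<in> L \<Longrightarrow> - x \<in> L" and Ldisc: "\<And>x. x \<in> L \<Longrightarrow> \<exists>U. open U \<and> U \<inter> L = {x}"
    using L by (auto simp: uniform_lattice_def)
  obtain U0 where U0: "open U0" "U0 \<inter> L = {0}" using Ldisc[OF L0] by blast
  then have "0 \<in> U0" by blast
  obtain U where U: "open U" "0 \<in> U" "\<And>a b. a \<in> U \<Longrightarrow> b \<in> U \<Longrightarrow> a - b \<in> U0"
    using open_nhds_zero_diff[OF U0(1) \<open>0 \<in> U0\<close>] by metis
  have "x \<in> set_mult U {x}" for x using U(2) set_mult_I[of 0 U x "{x}"] by simp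
  then obtain Y where Y: "Y \<subseteq> K" "finite Y" "K \<subseteq> (\<Union>x\<in>Y. set_mult U {x})"
    using compactE_image[OF K(1), of K "\<lambda>x. set_mult U {x}"] open_set_mult_right[OF U(1)]
    by (metis (no_types, lifting) UN_I subsetI)
  obtain ys where ys: "set ys = Y" using finite_list[OF Y(2)] by blast
  define n where "n = length ys"
  define A where "A i = K \<inter> set_mult U {ys ! i}" for i
  \<comment> \<open>All lattice translates of the earlier pieces are removed, not merely the pieces,
    so that different \<open>E i\<close> meet different cosets.\<close>
  define E where "E i = A i - (\<Union>j<i. \<Union>l\<in>L. (\<lambda>x. l + x) ` A j)" for i
  define F where "F = (\<Union>i<n. E i)"
  have A: "A i \<in> sets m" for i
    unfolding A_def by (intro sets.Int compact_in_sets open_in_sets K open_set_mult_right U)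
  have LA: "(\<Union>l\<in>L. (\<lambda>x. l + x) ` A j) \<in> sets m" for j
    using cL translate_in_sets[OF A] by (intro sets.countable_UN') auto
  have E: "E i \<in> sets m" for i
    unfolding E_def by (rule sets.Diff[OF A sets.finite_UN]) (simp_all only: finite_lessThan LA)
  have FK: "F \<subseteq> K" by (auto simp: F_def E_def A_def)
  have "compact (closure F)"
  proof -
    have "closure F \<subseteq> K" using FK compact_imp_closed[OF K(1)] by (rule closure_minimal)
    then show ?thesis using compact_Int_closed[OF K(1), of "closure F"] by (simp add: Int_absorb1)
  qed
  moreover have "F \<in> sets m" unfolding F_def by (intro sets.finite_UN E) auto
  moreover have "\<exists>!l. l \<in> L \<and> z \<in> (\<lambda>x. l + x) ` F" for z
  proof (rule ex_ex1I)
    obtain k l0 where kl: "k \<in> K" "l0 \<in> L" "z = l0 + k" using K(2) by blast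
    then obtain y where "y \<in> set ys" "k \<in> set_mult U {y}" using Y(3) ys by blast
    then obtain i0 where "i0 < n" "k \<in> A i0" using kl(1) by (auto simp: in_set_conv_nth n_def A_def)
    then have ex: "\<exists>i. i < n \<and> z \<in> (\<Union>l\<in>L. (\<lambda>x. l + x) ` A i)" using kl by blast
    \<comment> \<open>The first piece whose translates reach \<open>z\<close> yields a
      representative that survives the removal in \<open>E i\<close>.\<close>
    define i where "i = (LEAST i. i < n \<and> z \<in> (\<Union>l\<in>L. (\<lambda>x. l + x) ` A i))"
    have i: "i < n \<and> z \<in> (\<Union>l\<in>L. (\<lambda>x. l + x) ` A i)" unfolding i_def by (rule LeastI_ex[OF ex])
    then obtain l a where la: "l \<in> L" "a \<in> A i" "z = l + a" by blast
    have "a \<notin> (\<lambda>x. l' + x) ` A j" if "j < i" "l' \<in> L" for j l'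
    proof
      assume "a \<in> (\<lambda>x. l' + x) ` A j"
      then obtain b where "b \<in> A j" "z = (l + l') + b" using la by (auto simp: add.assoc)
      then have "j < n \<and> z \<in> (\<Union>l\<in>L. (\<lambda>x. l + x) ` A j)"
        using Ladd[OF la(1) that(2)] that(1) i by auto
      then show False using not_less_Least[OF that(1)[unfolded i_def]] by blast
    qed
    then have "a \<in> F" using la i by (auto simp: F_def E_def)
    then show "\<exists>l. l \<in> L \<and> z \<in> (\<lambda>x. l + x) ` F" using la by blast
  next
    fix l l' assume "l \<in> L \<and> z \<in> (\<lambda>x. l + x) ` F" "l' \<in> L \<and> z \<in> (\<lambda>x. l' + x) ` F"
    then obtain a b where abF: "a \<in> F" "b \<in> F" and ab': "l \<in> L" "l' \<in> L" "z = l + a" "z = l' + b"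
      by blast
    obtain i j where "i < n" "j < n" "a \<in> E i" "b \<in> E j" using abF by (auto simp: F_def)
    note ab = ab' this
    have not_less: "\<not> i < j" if "l \<in> L" "l' \<in> L" "l + a = l' + b" "a \<in> E i" "b \<in> E j" for l l' a b i j
    proof
      assume "i < j"
      have "b = (- l' + l) + a" using that(3) by (metis add.assoc minus_add_cancel)
      moreover have "a \<in> A i" using that(4) by (simp add: E_def)
      ultimately have "b \<in> (\<Union>j'<j. \<Union>l\<in>L. (\<lambda>x. l + x) ` A j')"
        using \<open>i < j\<close> Ladd[OF Lminus[OF that(2)] that(1)] by blast
      then show False using that(5) by (simp add: E_def)
    qed
    have "i = j"
      using not_less[of l l' a b i j] not_less[of l' l b a j i] ab by (metis linorder_neqE_nat)
    then obtain u v where uv: "u \<in> U" "v \<in> U" "a = u + ys ! i" "b = v + ys ! i"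
      using ab(7,8) by (auto simp: E_def A_def set_mult_def)
    \<comment> \<open>The base point \<open>ys ! i\<close> stands on the right and cancels. Thus
      \<open>- l' + l\<close> is a difference of elements of \<open>U\<close>, hence a lattice point
      in \<open>U0\<close>, hence 0.\<close>
    have "l + u = l' + v" using ab(3,4) uv(3,4) by (metis add.assoc add_right_cancel)
    then have "- l' + l = v - u" by (metis add.assoc add_diff_cancel minus_add_cancel)
    then have "- l' + l \<in> U0" using U(3)[OF uv(2,1)] by (simp only:)
    then have "- l' + l \<in> U0 \<inter> L" by (rule IntI[OF _ Ladd[OF Lminus[OF ab(2)] ab(1)]])
    then have "- l' + l = 0" by (simp only: U0(2) singleton_iff)
    moreover have "l = l' + (- l' + l)" by simp
    ultimately show "l = l'" by simp
  qed
  ultimately have "fundamental_domain m L F" unfolding fundamental_domain_def by blast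
  then show ?thesis using FK that by blast
qed

lemma fundamental_domainD:
  assumes "fundamental_domain m L F"
  shows "F \<in> sets m" "compact (closure F)" "(\<Union>l\<in>L. (\<lambda>x. l + x) ` F) = UNIV"
    "disjoint_family_on (\<lambda>l. (\<lambda>x. l + x) ` F) L"
proof -
  note dom = assms[unfolded fundamental_domain_def]
  show "F \<in> sets m" by (rule dom[THEN conjunct1])
  show "compact (closure F)" by (rule dom[THEN conjunct2, THEN conjunct1])
  note ex1 = dom[THEN conjunct2, THEN conjunct2]
  have "z \<in> (\<Union>l\<in>L. (\<lambda>x. l + x) ` F)" for z
    using ex1_implies_ex[OF ex1[rule_format, of z]] by blast
  then show "(\<Union>l\<in>L. (\<lambda>x. l + x) ` F) = UNIV" by blast
  show "disjoint_family_on (\<lambda>l. (\<lambda>x. l + x) ` F) L"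
    unfolding disjoint_family_on_def
  proof (intro ballI impI equals0I)
    fix l l' z assume l: "l \<in> L" "l' \<in> L" "l \<noteq> l'" "z \<in> (\<lambda>x. l + x) ` F \<inter> (\<lambda>x. l' + x) ` F"
    show False using ex1[rule_format, of z] l by (elim ex1E) (metis IntD1 IntD2)
  qed
qed

text \<open>Each domain is cut by the translates of the other. Translation by \<open>- l\<close>
  carries the piece of \<open>F\<close> in \<open>l + F'\<close> onto the piece of \<open>F'\<close>
  in \<open>- l + F\<close>, and inversion permutes \<open>L\<close>.\<close>

lemma fundamental_domain_emeasure_unique:
  assumes L: "uniform_lattice L" and F: "fundamental_domain m L F" and F': "fundamental_domain m L F'"
  shows "emeasure m F = emeasure m F'"
proof -
  have cL: "countable L" and Lminus: "\<And>x. x \<in> L \<Longrightarrow> - x \<in> L"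
    using L by (auto simp: uniform_lattice_def)
  have split: "emeasure m A = (\<integral>\<^sup>+l. emeasure m (A \<inter> (\<lambda>x. l + x) ` B) \<partial>count_space L)"
    if "A \<in> sets m" "fundamental_domain m L B" for A B
  proof -
    note B = fundamental_domainD[OF that(2)]
    have "A = (\<Union>l\<in>L. A \<inter> (\<lambda>x. l + x) ` B)" using B(3) by (simp add: Int_UN_distrib[symmetric])
    moreover have "disjoint_family_on (\<lambda>l. A \<inter> (\<lambda>x. l + x) ` B) L"
      using B(4) by (fastforce simp: disjoint_family_on_def)
    ultimately show ?thesis
      using emeasure_UN_countable[of L "\<lambda>l. A \<inter> (\<lambda>x. l + x) ` B" m] cL \<open>A \<in> sets m\<close> translate_in_sets[OF B(1)]
      by (simp add: sets.Int)
  qed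
  have sF: "F \<in> sets m" "F' \<in> sets m" by (rule fundamental_domainD[OF F], rule fundamental_domainD[OF F'])
  have flip: "emeasure m (F \<inter> (\<lambda>x. l + x) ` F') = emeasure m (F' \<inter> (\<lambda>x. - l + x) ` F)" for l
  proof -
    have "(\<lambda>x. - l + x) ` (F \<inter> (\<lambda>x. l + x) ` F') = F' \<inter> (\<lambda>x. - l + x) ` F"
      by (force simp: image_iff)
    then show ?thesis
      using emeasure_translate[of "F \<inter> (\<lambda>x. l + x) ` F'" "- l"] sF translate_in_sets by (metis sets.Int)
  qed
  have bij: "bij_betw uminus L L"
    by (rule bij_betw_byWitness[where f' = uminus]) (use Lminus in auto)
  have "emeasure m F = (\<integral>\<^sup>+l. emeasure m (F' \<inter> (\<lambda>x. - l + x) ` F) \<partial>count_space L)"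
    using split[OF sF(1) F'] by (simp add: flip)
  also have "\<dots> = (\<integral>\<^sup>+l. emeasure m (F' \<inter> (\<lambda>x. l + x) ` F) \<partial>count_space L)"
    using nn_integral_bij_count_space[OF bij, of "\<lambda>l. emeasure m (F' \<inter> (\<lambda>x. l + x) ` F)"] by simp
  also have "\<dots> = emeasure m F'" using split[OF sF(2) F] by simp
  finally show ?thesis .
qed

text \<open>Makes the choice hidden in \<open>covol\<close> harmless, so that a domain of convenient
  shape may be used.\<close>

lemma covol_eq:
  assumes "uniform_lattice L" "fundamental_domain m L F"
  shows "covol m L = measure m F"
proof -
  have "fundamental_domain m L (SOME F. fundamental_domain m L F)" by (rule someI[of _ F]) fact
  then show ?thesis
    using fundamental_domain_emeasure_unique[OF assms(1) _ assms(2)] by (simp add: covol_def measure_def)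
qed

lemma emeasure_fundamental_domain:
  assumes L: "uniform_lattice L" and F: "fundamental_domain m L F"
  shows "emeasure m F = ennreal (covol m L)"
proof -
  have "emeasure m F \<noteq> \<infinity>"
    by (rule emeasure_subset_compact_finite[OF closure_subset fundamental_domainD(2)[OF F]])
  then show ?thesis by (simp add: covol_eq[OF L F] emeasure_eq_ennreal_measure)
qed

text \<open>If a fundamental domain were null, its countably many translates would make the whole
  group null.\<close>

lemma covol_pos:
  assumes L: "uniform_lattice L"
  shows "0 < covol m L"
proof -
  obtain K where "compact K" "\<forall>z. \<exists>k\<in>K. \<exists>l\<in>L. z = l + k"
    using L unfolding uniform_lattice_def by blast
  then obtain F where F: "fundamental_domain m L F"
    using fundamental_domain_subset[OF L] by metis
  have sF: "F \<in> sets m" by (rule fundamental_domainD[OF F])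
  have "covol m L \<noteq> 0"
  proof
    assume "covol m L = 0"
    then have "emeasure m F = 0" using emeasure_fundamental_domain[OF L F] by simp
    then have "(\<lambda>x. l + x) ` F \<in> null_sets m" for l
      using sF by (simp add: null_sets_def translate_in_sets emeasure_translate)
    then have "(\<Union>l\<in>L. (\<lambda>x. l + x) ` F) \<in> null_sets m"
      using L by (intro null_sets_UN') (auto simp: uniform_lattice_def)
    moreover have "0 < emeasure m UNIV"
      using haar[unfolded haar_measure_def, THEN conjunct2, THEN conjunct2, THEN conjunct1, rule_format, of UNIV] by simp
    ultimately show False using fundamental_domainD(3)[OF F] by (simp add: null_sets_def)
  qed
  then show ?thesis unfolding covol_def using measure_nonneg by (simp add: less_le)
qed

lemma emeasure_Union_translates:
  assumes L: "uniform_lattice L" and F: "fundamental_domain m L F" and T: "finite T" "T \<subseteq> L"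
  shows "emeasure m (\<Union>l\<in>T. (\<lambda>x. l + x) ` F) = ennreal (real (card T) * covol m L)"
proof -
  have sF: "F \<in> sets m" by (rule fundamental_domainD[OF F])
  have disj: "disjoint_family_on (\<lambda>l. (\<lambda>x. l + x) ` F) T"
    by (rule disjoint_family_on_mono[OF T(2) fundamental_domainD(4)[OF F]])
  have "emeasure m (\<Union>l\<in>T. (\<lambda>x. l + x) ` F) = (\<Sum>l\<in>T. emeasure m ((\<lambda>x. l + x) ` F))"
    using translate_in_sets[OF sF] by (intro sum_emeasure[symmetric] disj T) auto
  also have "\<dots> = (\<Sum>l\<in>T. ennreal (covol m L))"
    by (simp add: emeasure_translate[OF sF] emeasure_fundamental_domain[OF L F])
  also have "\<dots> = ennreal (real (card T) * covol m L)"
    using covol_pos[OF L] by (simp add: ennreal_mult ennreal_of_nat_eq_real_of_nat)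
  finally show ?thesis .
qed

text \<open>The packing estimate: disjoint translates of \<open>F\<close> fit into \<open>C\<close>.
  The next lemma is the corresponding covering estimate.\<close>

lemma card_mult_covol_le:
  assumes "uniform_lattice L" "fundamental_domain m L F" "finite T" "T \<subseteq> L"
    and C: "compact C" "(\<Union>l\<in>T. (\<lambda>x. l + x) ` F) \<subseteq> C"
  shows "real (card T) * covol m L \<le> measure m C"
proof -
  have "ennreal (real (card T) * covol m L) \<le> emeasure m C"
    unfolding emeasure_Union_translates[OF assms(1-4), symmetric]
    by (rule emeasure_mono[OF C(2) compact_in_sets[OF C(1)]])
  also have "\<dots> = ennreal (measure m C)"
    using emeasure_compact_finite[OF C(1)] by (simp add: emeasure_eq_ennreal_measure less_top)
  finally show ?thesis by simp
qed

lemma measure_le_card_mult_covol: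
  assumes "uniform_lattice L" "fundamental_domain m L F" "finite T" "T \<subseteq> L"
    and C: "compact C" "C \<subseteq> (\<Union>l\<in>T. (\<lambda>x. l + x) ` F)"
  shows "measure m C \<le> real (card T) * covol m L"
proof -
  have "F \<in> sets m" by (rule fundamental_domainD[OF assms(2)])
  then have "emeasure m C \<le> emeasure m (\<Union>l\<in>T. (\<lambda>x. l + x) ` F)"
    using assms(3) by (intro emeasure_mono C sets.finite_UN translate_in_sets)
  then have "ennreal (measure m C) \<le> ennreal (real (card T) * covol m L)"
    using emeasure_compact_finite[OF C(1)] emeasure_Union_translates[OF assms(1-4)]
    by (simp add: emeasure_eq_ennreal_measure less_top)
  then show ?thesis using covol_pos[OF assms(1)] by simp
qed

end


section \<open>Leptin densities of model sets\<close>

lemma (in haar_group) inner_regular_open: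
  assumes U: "open U" "U \<subseteq> K" "compact K" and e: "0 < e"
  obtains C where "compact C" "C \<subseteq> U" "measure m U \<le> measure m C + e"
proof (cases "measure m U \<le> e")
  \<comment> \<open>Treated separately because \<open>ennreal\<close> truncates the negative number
    \<open>measure m U - e\<close> to 0, and the strict inequality used below could then
    fail.\<close>
  case True
  then show ?thesis using that[of "{}"] by simp
next
  case False
  have fin: "emeasure m U = ennreal (measure m U)"
    using emeasure_subset_compact_finite[OF U(2,3)] by (simp add: emeasure_eq_ennreal_measure)
  have "ennreal (measure m U - e) < emeasure m U"
    unfolding fin using False e by (intro ennreal_lessI) auto
  also have "\<dots> = (SUP C \<in> {C. compact C \<and> C \<subseteq> U}. emeasure m C)"
    using haar[unfolded haar_measure_def, THEN conjunct2, THEN conjunct2, THEN conjunct2, THEN conjunct2,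
        THEN conjunct2] U(1) by (elim allE[of _ U]) (rule mp)
  finally obtain C where C: "C \<in> {C. compact C \<and> C \<subseteq> U}" "ennreal (measure m U - e) < emeasure m C"
    unfolding less_SUP_iff by (rule bexE)
  then have "compact C" by simp
  have "ennreal (measure m U - e) < ennreal (measure m C)"
    using C(2) emeasure_compact_finite[OF \<open>compact C\<close>] by (simp add: emeasure_eq_ennreal_measure less_top)
  then have "measure m U - e < measure m C" using False by (simp add: ennreal_less_iff)
  then show ?thesis using that[of C] C(1) by simp
qed

text \<open>A cocompact set is squeezed in the second direction. By density every second coordinate
  in \<open>K0\<close> is moved into \<open>U\<close> by some lattice element, and by compactness
  finitely many elements suffice. The price is a larger compact set in the first direction.\<close>

lemma uniform_lattice_dense_cover:
  fixes L :: "('g::{topological_group_add,t2_space} \<times> 'h::{topological_group_add,t2_space}) set"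
  assumes L: "uniform_lattice L" and dense: "closure (snd ` L) = UNIV"
    and U: "open U" "0 \<in> U" "U \<subseteq> V"
  obtains K where "compact K" "K \<noteq> {}" "\<And>z. \<exists>k\<in>K \<times> V. \<exists>l\<in>L. z = l + k"
proof -
  obtain K0 where K0: "compact K0" "\<And>z. \<exists>k\<in>K0. \<exists>l\<in>L. z = l + k"
    using L unfolding uniform_lattice_def by blast
  define N where "N l = {h. - snd l + h \<in> U}" for l :: "'g \<times> 'h"
  have N: "open (N l)" for l
  proof -
    have "open ((\<lambda>h. - snd l + h) -` U)" by (intro open_vimage U continuous_intros)
    then show ?thesis by (simp add: N_def vimage_def)
  qed
  have cov: "\<exists>l\<in>L. h \<in> N l" for h
  proof -
    have "open ((\<lambda>t. - t + h) -` U)" by (intro open_vimage U continuous_intros)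
    moreover have "h \<in> (\<lambda>t. - t + h) -` U" using U by simp
    ultimately have "(\<lambda>t. - t + h) -` U \<inter> snd ` L \<noteq> {}"
      using open_Int_closure_eq_empty[of "(\<lambda>t. - t + h) -` U" "snd ` L"] unfolding dense by blast
    then show ?thesis by (auto simp: N_def)
  qed
  have cK: "compact (fst ` K0)" "compact (snd ` K0)"
    using K0(1) by (auto intro!: compact_continuous_image continuous_intros)
  have "snd ` K0 \<subseteq> (\<Union>l\<in>L. N l)" using cov by blast
  then obtain L' where L': "L' \<subseteq> L" "finite L'" "snd ` K0 \<subseteq> (\<Union>l\<in>L'. N l)"
    using compactE_image[OF cK(2), of L N] N by metis
  \<comment> \<open>Contains the first coordinates of all \<open>- l' + k\<close> with
    \<open>k \<in> K0\<close> and \<open>l' \<in> L'\<close>, since \<open>z = l + k\<close> will be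
    rewritten as \<open>(l + l') + (- l' + k)\<close>.\<close>
  define K where "K = (\<Union>l\<in>L'. (\<lambda>x. - fst l + x) ` fst ` K0)"
  have "compact K" unfolding K_def by (intro compact_UN L' compact_translate cK)
  have ex: "\<exists>k\<in>K \<times> V. \<exists>l\<in>L. z = l + k" for z
  proof -
    obtain k l where kl: "k \<in> K0" "l \<in> L" "z = l + k" using K0(2) by blast
    then obtain l' where l': "l' \<in> L'" "- snd l' + snd k \<in> U" using L'(3) by (auto simp: N_def)
    have "- l' + k \<in> K \<times> V"
      using kl(1) l' U(3) by (auto simp: K_def mem_Times_iff fst_add snd_add fst_uminus snd_uminus)
    moreover have "l + l' \<in> L" using L kl(2) l'(1) L'(1) by (auto simp: uniform_lattice_def)
    moreover have "z = (l + l') + (- l' + k)" using kl(3) by (simp add: add.assoc)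
    ultimately show ?thesis by (intro bexI[of _ "- l' + k"] bexI[of _ "l + l'"])
  qed
  have "K \<noteq> {}" using ex[of 0] by auto
  show ?thesis by (rule that[OF \<open>compact K\<close> \<open>K \<noteq> {}\<close> ex])
qed

text \<open>Injectivity of the first projection turns counting in the model set into counting
  lattice points in a box.\<close>

lemma card_model_set:
  assumes "inj_on fst L"
  shows "finite (model_set L S \<inter> A) \<longleftrightarrow> finite (L \<inter> (A \<times> S))"
    "card (model_set L S \<inter> A) = card (L \<inter> (A \<times> S))"
proof -
  have eq: "model_set L S \<inter> A = fst ` (L \<inter> (A \<times> S))" by (force simp: model_set_def)
  have inj: "inj_on fst (L \<inter> (A \<times> S))" using assms by (rule inj_on_subset) auto
  show "finite (model_set L S \<inter> A) \<longleftrightarrow> finite (L \<inter> (A \<times> S))"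
    unfolding eq using inj by (rule finite_image_iff)
  show "card (model_set L S \<inter> A) = card (L \<inter> (A \<times> S))"
    unfolding eq using inj by (rule card_image)
qed

lemma model_set_mono: "S \<subseteq> T \<Longrightarrow> model_set L S \<subseteq> model_set L T"
  unfolding model_set_def by blast

lemma countable_model_set: "countable L \<Longrightarrow> countable (model_set L S)"
  unfolding model_set_def by (rule countable_image[OF countable_subset[OF Int_lower1]])

section \<open>Counting points of model sets by comparing Haar measures\<close>

locale cut_and_project =
  fixes mG :: "'g::{topological_group_add,t2_space} measure"
    and mH :: "'h::{topological_group_add,t2_space} measure"
    and m :: "('g \<times> 'h) measure" and L :: "('g \<times> 'h) set"
  assumes cps: "cut_and_project_scheme mG mH L" and prod: "product_haar mG mH m"
begin

lemma L: "uniform_lattice L" "inj_on fst L" "closure (snd ` L) = UNIV"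
  and L_countable: "countable L" and L_uminus: "x \<in> L \<Longrightarrow> - x \<in> L"
  using cps by (auto simp: cut_and_project_scheme_def uniform_lattice_def)

sublocale G: unimodular_haar_group mG
  using cps by unfold_locales (simp_all add: cut_and_project_scheme_def)

sublocale H: unimodular_haar_group mH
  using cps by unfold_locales (simp_all add: cut_and_project_scheme_def)

sublocale GH: haar_group m
  using prod by unfold_locales (simp add: product_haar_def)

lemma measure_Times:
  assumes "compact A" "compact B"
  shows "measure m (A \<times> B) = measure mG A * measure mH B"
  using prod assms by (simp add: product_haar_def measure_def enn2real_mult)

text \<open>For \<open>t\<close> in \<open>L \<inter> (A \<times> S)\<close> the disjoint tiles
  \<open>- t + F\<close> lie in the box with sides \<open>-A + K\<close> and \<open>-S + V\<close>.
  Inversion turns these sides into \<open>-K + A\<close> and \<open>V0 + S\<close>, so the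
  thickening ends up on the left of \<open>A\<close> and the second side has measure at most
  \<open>measure mH S + e\<close>.\<close>

lemma model_set_card_le:
  assumes S: "compact S" and e: "0 < e"
  obtains K where "compact K" "K \<noteq> {}"
    "\<And>A. compact A \<Longrightarrow> finite (model_set L S \<inter> A) \<and>
      real (card (model_set L S \<inter> A)) * covol m L \<le> measure mG (set_mult K A) * (measure mH S + e)"
proof -
  obtain W where W: "open W" "S \<subseteq> W" "\<And>C. compact C \<Longrightarrow> C \<subseteq> W \<Longrightarrow> measure mH C \<le> measure mH S + e"
    using H.outer_regular_compact[OF S e] by metis
  obtain U0 V0 where UV0: "open U0" "0 \<in> U0" "U0 \<subseteq> V0" "compact V0" "set_mult V0 S \<subseteq> W"
    using compact_nhds_zero_set_mult_subset[OF H.lc S W(1,2)] by metis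
  define V where "V = uminus ` V0"
  have V: "compact V" unfolding V_def by (rule compact_uminus) fact
  have "open (uminus ` U0)" "0 \<in> uminus ` U0" "uminus ` U0 \<subseteq> V"
    using UV0 by (auto simp: V_def image_iff intro: open_uminus)
  then obtain K where K: "compact K" "K \<noteq> {}" "\<And>z. \<exists>k\<in>K \<times> V. \<exists>l\<in>L. z = l + k"
    using uniform_lattice_dense_cover[OF L(1,3)] by metis
  obtain F where F: "fundamental_domain m L F" "F \<subseteq> K \<times> V"
    using GH.fundamental_domain_subset[OF L(1) compact_Times[OF K(1) V] K(3)] by metis
  show ?thesis
  proof (rule that[of "uminus ` K"])
    show "compact (uminus ` K)" "uminus ` K \<noteq> {}" using K by (auto intro: compact_uminus)
    fix A :: "'g set" assume A: "compact A"
    define C where "C = set_mult (uminus ` A) K \<times> set_mult (uminus ` S) V"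
    have cA: "compact (set_mult (uminus ` A) K)" and cS: "compact (set_mult (uminus ` S) V)"
      using A S K V by (auto intro!: compact_set_mult compact_uminus)
    have "measure mG (set_mult (uminus ` A) K) = measure mG (uminus ` set_mult (uminus ` A) K)"
      using G.measure_uminus_compact[OF cA] by simp
    also have "\<dots> = measure mG (set_mult (uminus ` K) A)"
      by (simp add: uminus_set_mult image_image)
    finally have mGA: "measure mG (set_mult (uminus ` A) K) = measure mG (set_mult (uminus ` K) A)" .
    have "measure mH (set_mult (uminus ` S) V) = measure mH (uminus ` set_mult (uminus ` S) V)"
      using H.measure_uminus_compact[OF cS] by simp
    also have "\<dots> = measure mH (set_mult V0 S)"
      by (simp add: uminus_set_mult image_image V_def)
    also have "\<dots> \<le> measure mH S + e"
      by (intro W(3) compact_set_mult UV0 S)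
    finally have mHS: "measure mH (set_mult (uminus ` S) V) \<le> measure mH S + e" .
    \<comment> \<open>Stated for arbitrary finite subsets, because finiteness of
      \<open>L \<inter> (A \<times> S)\<close> is itself deduced from this uniform bound.\<close>
    have bound: "real (card T) * covol m L \<le> measure mG (set_mult (uminus ` K) A) * (measure mH S + e)"
      if T: "finite T" "T \<subseteq> L \<inter> (A \<times> S)" for T
    proof -
      have "(\<Union>l\<in>uminus ` T. (\<lambda>x. l + x) ` F) \<subseteq> C"
      proof
        fix z assume "z \<in> (\<Union>l\<in>uminus ` T. (\<lambda>x. l + x) ` F)"
        then obtain t f where "t \<in> T" "f \<in> F" "z = - t + f" by blast
        moreover from this have "fst t \<in> A" "snd t \<in> S" "fst f \<in> K" "snd f \<in> V" using T(2) F(2) by auto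
        ultimately show "z \<in> C" by (simp add: C_def mem_Times_iff set_mult_I)
      qed
      moreover have "uminus ` T \<subseteq> L" using T(2) L_uminus by auto
      moreover have "compact C" unfolding C_def by (intro compact_Times cA cS)
      ultimately have "real (card (uminus ` T)) * covol m L \<le> measure m C"
        using T(1) by (intro GH.card_mult_covol_le[OF L(1) F(1)]) auto
      also have "measure m C = measure mG (set_mult (uminus ` K) A) * measure mH (set_mult (uminus ` S) V)"
        unfolding C_def by (simp add: measure_Times[OF cA cS] mGA)
      also have "\<dots> \<le> measure mG (set_mult (uminus ` K) A) * (measure mH S + e)"
        using mHS by (intro mult_left_mono) auto
      finally show ?thesis by (simp add: card_image)
    qed
    have fin: "finite (L \<inter> (A \<times> S))"
    proof (rule ccontr)
      assume inf: "infinite (L \<inter> (A \<times> S))"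
      define R where "R = measure mG (set_mult (uminus ` K) A) * (measure mH S + e)"
      obtain n :: nat where n: "R / covol m L < real n" using reals_Archimedean2 by blast
      obtain T where T: "finite T" "card T = n" "T \<subseteq> L \<inter> (A \<times> S)"
        using infinite_arbitrarily_large[OF inf] by blast
      have "real n * covol m L \<le> R" using bound[OF T(1,3)] T(2) by (simp add: R_def)
      then show False using n GH.covol_pos[OF L(1)] by (simp add: field_simps)
    qed
    then show "finite (model_set L S \<inter> A) \<and>
      real (card (model_set L S \<inter> A)) * covol m L \<le> measure mG (set_mult (uminus ` K) A) * (measure mH S + e)"
      using bound[OF fin order_refl] by (simp add: card_model_set[OF L(2)])
  qed
qed

text \<open>A tile \<open>l + F\<close> that meets the box with sides \<open>-A\<close> and
  \<open>-C\<close> has \<open>- l\<close> in \<open>K + A\<close> times \<open>V + C\<close>.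
  Choosing \<open>C\<close> compact inside \<open>S\<close> leaves room for
  \<open>V + C \<subseteq> S\<close>, so tiles indexed by points counted in the model set cover the
  box. An infinite count needs no estimate, because \<open>delta\<close> is then infinite.\<close>

lemma model_set_card_ge:
  assumes S: "open S" "S \<subseteq> Q" "compact Q" and e: "0 < e"
  obtains K where "compact K" "K \<noteq> {}"
    "\<And>A. compact A \<Longrightarrow> finite (model_set L S \<inter> set_mult K A) \<Longrightarrow>
      measure mG A * (measure mH S - e) \<le> real (card (model_set L S \<inter> set_mult K A)) * covol m L"
proof -
  obtain C where C: "compact C" "C \<subseteq> S" "measure mH S \<le> measure mH C + e"
    using H.inner_regular_open[OF S e] by metis
  obtain U V where UV: "open U" "0 \<in> U" "U \<subseteq> V" "compact V" "set_mult V C \<subseteq> S"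
    using compact_nhds_zero_set_mult_subset[OF H.lc C(1) S(1) C(2)] by metis
  obtain K where K: "compact K" "K \<noteq> {}" "\<And>z. \<exists>k\<in>K \<times> V. \<exists>l\<in>L. z = l + k"
    using uniform_lattice_dense_cover[OF L(1,3) UV(1-3)] by metis
  obtain F where F: "fundamental_domain m L F" "F \<subseteq> K \<times> V"
    using GH.fundamental_domain_subset[OF L(1) compact_Times[OF K(1) UV(4)] K(3)] by metis
  show ?thesis
  proof (rule that[OF K(1,2)])
    fix A :: "'g set" assume A: "compact A" and "finite (model_set L S \<inter> set_mult K A)"
    define T where "T = L \<inter> (set_mult K A \<times> S)"
    have T: "finite T" unfolding T_def using card_model_set(1)[OF L(2)] \<open>finite (model_set L S \<inter> _)\<close> by blast
    have "(uminus ` A) \<times> (uminus ` C) \<subseteq> (\<Union>l\<in>uminus ` T. (\<lambda>x. l + x) ` F)"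
    proof
      fix z assume "z \<in> (uminus ` A) \<times> (uminus ` C)"
      then obtain a c where ac: "a \<in> A" "c \<in> C" "z = - (a, c)" by auto
      have "z \<in> (\<Union>l\<in>L. (\<lambda>x. l + x) ` F)" using GH.fundamental_domainD(3)[OF F(1)] by simp
      then obtain l f where lf: "l \<in> L" "f \<in> F" "z = l + f" by blast
      have "- l = f + (a, c)"
      proof -
        have "l = z - f" using lf(3) by simp
        then show ?thesis using ac(3) by (simp add: prod_eq_iff)
      qed
      moreover have "f + (a, c) \<in> set_mult K A \<times> S"
      proof -
        have "fst f \<in> K" "snd f \<in> V" using F(2) lf(2) by auto
        then have "fst f + a \<in> set_mult K A" "snd f + c \<in> set_mult V C" using ac by (auto intro: set_mult_I)
        then show ?thesis using UV(5) by (auto simp: mem_Times_iff)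
      qed
      ultimately have "- l \<in> T" using L_uminus[OF lf(1)] by (simp add: T_def)
      then have "l \<in> uminus ` T" by (intro image_eqI[of _ _ "- l"]) auto
      then show "z \<in> (\<Union>l\<in>uminus ` T. (\<lambda>x. l + x) ` F)" using lf by blast
    qed
    moreover have "uminus ` T \<subseteq> L" using L_uminus by (auto simp: T_def)
    moreover have "compact ((uminus ` A) \<times> (uminus ` C))"
      by (intro compact_Times compact_uminus A C)
    ultimately have "measure m ((uminus ` A) \<times> (uminus ` C)) \<le> real (card (uminus ` T)) * covol m L"
      using T by (intro GH.measure_le_card_mult_covol[OF L(1) F(1)]) auto
    then have "measure mG A * measure mH C \<le> real (card T) * covol m L"
      by (simp add: measure_Times compact_uminus A C G.measure_uminus_compact H.measure_uminus_compact card_image)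
    moreover have "measure mG A * (measure mH S - e) \<le> measure mG A * measure mH C"
      using C(3) by (intro mult_left_mono) auto
    ultimately show "measure mG A * (measure mH S - e) \<le> real (card (model_set L S \<inter> set_mult K A)) * covol m L"
      by (simp add: card_model_set(2)[OF L(2)] T_def)
  qed
qed

lemma leptin_upper_model_set_le:
  assumes S: "compact S"
  shows "leptin_upper mG (delta (model_set L S)) \<le> ereal (measure mH S / covol m L)"
proof (rule ereal_le_epsilon2)
  fix e' :: real assume "0 < e'"
  have cov: "0 < covol m L" by (rule GH.covol_pos[OF L(1)])
  \<comment> \<open>Scaled so that division by the covolume leaves the error
    \<open>e'\<close>.\<close>
  define e where "e = e' * covol m L"
  have e: "0 < e" using \<open>0 < e'\<close> cov by (simp add: e_def)
  obtain K where K: "compact K" "K \<noteq> {}"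
    "\<And>A. compact A \<Longrightarrow> finite (model_set L S \<inter> A) \<and>
      real (card (model_set L S \<inter> A)) * covol m L \<le> measure mG (set_mult K A) * (measure mH S + e)"
    using model_set_card_le[OF S e] by metis
  have "delta (model_set L S) A / ereal (measure mG (set_mult K A)) \<le> ereal ((measure mH S + e) / covol m L)"
    if A: "compact A" "A \<noteq> {}" "0 < measure mG A" for A
  proof -
    have pos: "0 < measure mG (set_mult K A)" by (rule G.measure_pos_set_mult[OF K(1,2) A(1,3)])
    show ?thesis
      using K(3)[OF A(1)] pos cov by (simp add: delta_def field_simps)
  qed
  then have "leptin_upper mG (delta (model_set L S)) \<le> ereal ((measure mH S + e) / covol m L)"
    unfolding leptin_upper_def using K(1,2) by (intro INF_lower2[of K] SUP_least) auto
  also have "\<dots> = ereal (measure mH S / covol m L) + ereal e'"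
    using cov by (simp add: e_def field_simps)
  finally show "leptin_upper mG (delta (model_set L S)) \<le> ereal (measure mH S / covol m L) + ereal e'" .
qed

lemma leptin_lower_model_set_ge:
  assumes S: "open S" "S \<subseteq> Q" "compact Q"
  shows "ereal (measure mH S / covol m L) \<le> leptin_lower mG (delta (model_set L S))"
proof (rule ereal_le_epsilon2)
  fix e' :: real assume "0 < e'"
  have cov: "0 < covol m L" by (rule GH.covol_pos[OF L(1)])
  define e where "e = e' * covol m L"
  have e: "0 < e" using \<open>0 < e'\<close> cov by (simp add: e_def)
  obtain K where K: "compact K" "K \<noteq> {}"
    "\<And>A. compact A \<Longrightarrow> finite (model_set L S \<inter> set_mult K A) \<Longrightarrow>
      measure mG A * (measure mH S - e) \<le> real (card (model_set L S \<inter> set_mult K A)) * covol m L"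
    using model_set_card_ge[OF S e] by metis
  have "ereal ((measure mH S - e) / covol m L) \<le> delta (model_set L S) (set_mult K A) / ereal (measure mG A)"
    if A: "compact A" "A \<noteq> {}" "0 < measure mG A" for A
    using K(3)[OF A(1)] A(3) cov by (auto simp: delta_def field_simps)
  then have "ereal ((measure mH S - e) / covol m L) \<le> leptin_lower mG (delta (model_set L S))"
    unfolding leptin_lower_def using K(1,2) by (intro SUP_upper2[of K] INF_greatest) auto
  \<comment> \<open>The error is added back on both sides, which avoids subtraction in the extended
    reals.\<close>
  then have "ereal ((measure mH S - e) / covol m L) + ereal e' \<le> leptin_lower mG (delta (model_set L S)) + ereal e'"
    by (rule add_right_mono)
  moreover have "ereal ((measure mH S - e) / covol m L) + ereal e' = ereal (measure mH S / covol m L)"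
    using cov by (simp add: e_def field_simps)
  ultimately show "ereal (measure mH S / covol m L) \<le> leptin_lower mG (delta (model_set L S)) + ereal e'"
    by simp
qed

end

section \<open>Monotonicity, Riemann measurable windows and the chain of inequalities\<close>

lemma leptin_lower_mono:
  fixes S T :: "'a::{plus,topological_space} set"
  assumes "S \<subseteq> T"
  shows "leptin_lower m (delta S) \<le> leptin_lower m (delta T)"
  unfolding leptin_lower_def
proof (rule SUP_subset_mono[OF order_refl], rule INF_superset_mono[OF order_refl])
  fix K A :: "'a set" assume "A \<in> {A. compact A \<and> A \<noteq> {} \<and> 0 < measure m A}"
  then show "delta S (set_mult K A) / ereal (measure m A) \<le> delta T (set_mult K A) / ereal (measure m A)"
    by (intro ereal_divide_right_mono delta_mono assms order_refl) simp
qed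

text \<open>Here the denominators are measures of \<open>K + A\<close>, and their positivity rests
  on translation invariance; for the lower density it is built into the range of
  \<open>A\<close>.\<close>

lemma leptin_upper_mono:
  fixes m :: "'a::{topological_group_add,t2_space} measure"
  assumes "unimodular_haar_group m" "S \<subseteq> T"
  shows "leptin_upper m (delta S) \<le> leptin_upper m (delta T)"
proof -
  interpret unimodular_haar_group m by fact
  show ?thesis
    unfolding leptin_upper_def
  proof (rule INF_superset_mono[OF order_refl], rule SUP_subset_mono[OF order_refl])
    fix K A :: "'a set"
    assume "K \<in> {K. compact K \<and> K \<noteq> {}}" "A \<in> {A. compact A \<and> A \<noteq> {} \<and> 0 < measure m A}"
    then have "0 < measure m (set_mult K A)" using measure_pos_set_mult by blast
    then show "delta S A / ereal (measure m (set_mult K A)) \<le> delta T A / ereal (measure m (set_mult K A))"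
      by (intro ereal_divide_right_mono delta_mono assms) auto
  qed
qed

text \<open>\<open>W\<close> need not be Borel, but it differs from its interior by a subset of a
  null set. Its measure is therefore taken in the completion.\<close>

lemma (in haar_group) measure_between_riemann_measurable:
  assumes W: "compact (closure W)" "riemann_measurable m W"
  shows "measure m (interior W) = measure m (closure W)"
    "measure (completion m) W = measure m (closure W)"
proof -
  have s: "interior W \<in> sets m" "closure W \<in> sets m" using open_in_sets compact_in_sets W(1) by auto
  have sub: "interior W \<subseteq> closure W" using interior_subset closure_subset by blast
  have fin: "emeasure m (closure W - interior W) \<noteq> \<infinity>" "emeasure m (closure W) \<noteq> \<infinity>"
    by (rule emeasure_subset_compact_finite[OF _ W(1)]; blast)+
  \<comment> \<open>\<open>measure\<close> is 0 also on sets of infinite measure; compactness of the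
    closure excludes that case, so the boundary is truly null.\<close>
  have null: "closure W - interior W \<in> null_sets m"
    using W(2) fin(1) s by (auto simp: riemann_measurable_def measure_def enn2real_eq_0_iff null_sets_def)
  have "emeasure m (interior W \<union> (closure W - interior W)) = emeasure m (interior W)"
    using null s by (intro emeasure_Un_null_set) auto
  moreover have "interior W \<union> (closure W - interior W) = closure W" using sub by blast
  ultimately have eq: "emeasure m (interior W) = emeasure m (closure W)" by simp
  then show "measure m (interior W) = measure m (closure W)" by (simp add: measure_def)
  have "W - interior W \<in> sets (completion m)"
    by (rule null_setsD2[OF null_sets_completion_subset[OF Diff_mono[OF closure_subset order_refl] null_sets_completionI[OF null]]])
  then have "interior W \<union> (W - interior W) \<in> sets (completion m)" using s by (intro sets.Un) auto
  moreover have "interior W \<union> (W - interior W) = W" using interior_subset[of W] by blast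
  ultimately have sW: "W \<in> sets (completion m)" by simp
  have "emeasure (completion m) (interior W) \<le> emeasure (completion m) W"
    by (rule emeasure_mono[OF interior_subset sW])
  moreover have "emeasure (completion m) W \<le> emeasure (completion m) (closure W)"
    using s by (intro emeasure_mono closure_subset) auto
  ultimately have "emeasure (completion m) W = emeasure m (closure W)"
    using s eq by simp
  then show "measure (completion m) W = measure m (closure W)" by (simp add: measure_def)
qed

theorem theorem7p2:
  fixes mG :: "('g::{topological_group_add,t2_space}) measure"
    and mH :: "('h::{topological_group_add,t2_space}) measure"
    and m :: "('g \<times> 'h) measure"
    and L :: "('g \<times> 'h) set"
    and W :: "'h set"
  assumes cps: "cut_and_project_scheme mG mH L"
    and prod: "product_haar mG mH m"
    and amen: "amenable mG"
    and relc: "compact (closure W)"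
  shows "ereal (measure mH (interior W) / covol m L)
           \<le> leptin_lower mG (delta (model_set L (interior W)))
       \<and> leptin_lower mG (delta (model_set L (interior W)))
           \<le> leptin_lower mG (delta (model_set L W))
       \<and> leptin_lower mG (delta (model_set L W))
           \<le> leptin_upper mG (delta (model_set L W))
       \<and> leptin_upper mG (delta (model_set L W))
           \<le> leptin_upper mG (delta (model_set L (closure W)))
       \<and> leptin_upper mG (delta (model_set L (closure W)))
           \<le> ereal (measure mH (closure W) / covol m L)
       \<and> (riemann_measurable mH W \<longrightarrow>
            leptin_lower mG (delta (model_set L W)) = leptin_upper mG (delta (model_set L W))
          \<and> leptin_lower mG (delta (model_set L W))
              = ereal (measure (completion mH) W / covol m L))"
proof -
  interpret cut_and_project mG mH m L using cps prod by unfold_locales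
  have sub: "interior W \<subseteq> closure W" using interior_subset closure_subset by blast
  have 1: "ereal (measure mH (interior W) / covol m L) \<le> leptin_lower mG (delta (model_set L (interior W)))"
    by (rule leptin_lower_model_set_ge[OF open_interior sub relc])
  have 2: "leptin_lower mG (delta (model_set L (interior W))) \<le> leptin_lower mG (delta (model_set L W))"
    by (intro leptin_lower_mono model_set_mono interior_subset)
  have 3: "leptin_lower mG (delta (model_set L W)) \<le> leptin_upper mG (delta (model_set L W))"
    by (rule G.leptin_lower_le_upper[OF amen countable_model_set[OF L_countable]])
  have 4: "leptin_upper mG (delta (model_set L W)) \<le> leptin_upper mG (delta (model_set L (closure W)))"
    by (intro leptin_upper_mono model_set_mono closure_subset G.unimodular_haar_group_axioms)
  have 5: "leptin_upper mG (delta (model_set L (closure W))) \<le> ereal (measure mH (closure W) / covol m L)"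
    by (rule leptin_upper_model_set_le[OF relc])
  have "leptin_lower mG (delta (model_set L W)) = leptin_upper mG (delta (model_set L W))
      \<and> leptin_lower mG (delta (model_set L W)) = ereal (measure (completion mH) W / covol m L)"
    if R: "riemann_measurable mH W"
  proof -
    \<comment> \<open>Interior, closure and \<open>W\<close> itself now have equal measure, so the
      two ends of the chain coincide and force equality throughout.\<close>
    note eq = H.measure_between_riemann_measurable[OF relc R]
    have "leptin_upper mG (delta (model_set L W)) \<le> ereal (measure (completion mH) W / covol m L)"
      using order_trans[OF 4 5] by (simp only: eq(2))
    moreover have "ereal (measure (completion mH) W / covol m L) \<le> leptin_lower mG (delta (model_set L W))"
      using order_trans[OF 1 2] by (simp only: eq)
    ultimately show ?thesis using 3 by (meson order_antisym order_trans)
  qed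
  then show ?thesis using 1 2 3 4 5 by blast
qed

end
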